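(* There exist a $\sigma$-finite measure space $(X,\mathfrak A,\mu)$ and an irreducible Dirichlet form $\mathcal E$ on $L^2(X,\mu)$ with $\ker\mathcal E_e=\mathbb R1$ such that $(D(\mathcal E_e)/\mathbb R1,\mathcal E_e)$ is not a Hilbert space.
   Context: A quadratic form $q\colon L^2(X,\mu)\to[0,\infty]$ satisfies $q(\lambda f)=\lambda^2q(f)$ ($0\cdot\infty=0$) and the parallelogram identity; $D(q)=\{q<\infty\}$, $\ker q=\{q=0\}$. It is closed if $D(q)$ is complete with respect to $q(f-g)^{1/2}+\|f-g\|_2$. A Dirichlet form $\mathcal E$ is a closed, densely defined quadratic form on $L^2(X,\mu)$ with $\mathcal E(|f|)\le\mathcal E(f)$ and $\mathcal E(f\wedge1)\le\mathcal E(f)$ for all $f\in L^2(X,\mu)$. A measurable $A\subseteq X$ is $\mathcal E$-invariant if $\mathcal E(1_Af)\le\mathcal E(f)$ for all $f\in L^2(X,\mu)$; $\mathcal E$ is irreducible if each invariant $A$ satisfies $\mu(A)=0$ or $\mu(X\setminus A)=0$. $L^0(X,\mu)$ is the space of a.e.-classes of measurable real-valued functions with the topology of local convergence in measure ($f_n\to f$ iff each subsequence has a further subsequence converging to $f$ a.e.). The extended form $\mathcal E_e\colon L^0(X,\mu)\to[0,\infty]$ is given by $\mathcal E_e(f)=\lim_n\mathcal E(f_n)$ if there is an $\mathcal E$-Cauchy sequence $(f_n)$ in $D(\mathcal E)$ with $f_n\to f$ in $L^0(X,\mu)$, and $\mathcal E_e(f)=\infty$ otherwise; it is a well-defined quadratic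 form with domain $D(\mathcal E_e)=\{\mathcal E_e<\infty\}$ and kernel $\ker\mathcal E_e=\{\mathcal E_e=0\}$. $D(\mathcal E_e)/\mathbb R1$ carries the inner product induced by $\mathcal E_e$. *)

theory Defs
  imports "HOL-Analysis.Analysis"
begin

text \<open>
  Elements of \<open>L\<^sup>0(X,\<mu>)\<close> and \<open>L\<^sup>2(X,\<mu>)\<close> are represented by measurable functions. A form on
  \<open>L\<^sup>2(X,\<mu>)\<close> is a function of representatives that is constant on a.e.-classes; its values
  outside \<open>L\<^sup>2\<close> are irrelevant.
\<close>

definition L2 :: "'a measure \<Rightarrow> ('a \<Rightarrow> real) set" where
  "L2 M = {f \<in> borel_measurable M. integrable M (\<lambda>x. (f x)\<^sup>2)}"

definition L2_dist :: "'a measure \<Rightarrow> ('a \<Rightarrow> real) \<Rightarrow> ('a \<Rightarrow> real) \<Rightarrow> real" where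
  "L2_dist M f g = sqrt (LINT x|M. (f x - g x)\<^sup>2)"

text \<open>
  Sequential completeness, for a distance that may vanish off the diagonal (as it does between
  representatives of the same a.e.-class).
\<close>

definition complete_wrt :: "'b set \<Rightarrow> ('b \<Rightarrow> 'b \<Rightarrow> real) \<Rightarrow> bool" where
  "complete_wrt S d \<longleftrightarrow>
    (\<forall>u :: nat \<Rightarrow> 'b.
       (\<forall>n. u n \<in> S) \<and> (\<forall>e>0. \<exists>N. \<forall>m\<ge>N. \<forall>n\<ge>N. d (u m) (u n) < e)
         \<longrightarrow> (\<exists>x\<in>S. (\<lambda>n. d (u n) x) \<longlonglongrightarrow> 0))"


section \<open>Dirichlet forms\<close>

definition quadratic_form :: "'a measure \<Rightarrow> (('a \<Rightarrow> real) \<Rightarrow> ennreal) \<Rightarrow> bool" where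
  "quadratic_form M q \<longleftrightarrow>
    (\<forall>f\<in>L2 M. \<forall>g\<in>L2 M. (AE x in M. f x = g x) \<longrightarrow> q f = q g) \<and>
    (\<forall>f\<in>L2 M. \<forall>c::real. q (\<lambda>x. c * f x) = ennreal (c\<^sup>2) * q f) \<and>
    (\<forall>f\<in>L2 M. \<forall>g\<in>L2 M.
       q (\<lambda>x. f x + g x) + q (\<lambda>x. f x - g x) = 2 * q f + 2 * q g)"

definition form_domain :: "'a measure \<Rightarrow> (('a \<Rightarrow> real) \<Rightarrow> ennreal) \<Rightarrow> ('a \<Rightarrow> real) set" where
  "form_domain M q = {f \<in> L2 M. q f < \<infinity>}"

definition closed_form :: "'a measure \<Rightarrow> (('a \<Rightarrow> real) \<Rightarrow> ennreal) \<Rightarrow> bool" where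
  "closed_form M q \<longleftrightarrow>
    complete_wrt (form_domain M q)
      (\<lambda>f g. sqrt (enn2real (q (\<lambda>x. f x - g x))) + L2_dist M f g)"

definition densely_defined :: "'a measure \<Rightarrow> (('a \<Rightarrow> real) \<Rightarrow> ennreal) \<Rightarrow> bool" where
  "densely_defined M q \<longleftrightarrow> (\<forall>f\<in>L2 M. \<forall>e>0. \<exists>g\<in>form_domain M q. L2_dist M f g < e)"

definition dirichlet_form :: "'a measure \<Rightarrow> (('a \<Rightarrow> real) \<Rightarrow> ennreal) \<Rightarrow> bool" where
  "dirichlet_form M E \<longleftrightarrow>
    quadratic_form M E \<and> closed_form M E \<and> densely_defined M E \<and>
    (\<forall>f\<in>L2 M. E (\<lambda>x. \<bar>f x\<bar>) \<le> E f) \<and>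
    (\<forall>f\<in>L2 M. E (\<lambda>x. min (f x) 1) \<le> E f)"

definition invariant_set :: "'a measure \<Rightarrow> (('a \<Rightarrow> real) \<Rightarrow> ennreal) \<Rightarrow> 'a set \<Rightarrow> bool" where
  "invariant_set M E A \<longleftrightarrow>
    A \<in> sets M \<and> (\<forall>f\<in>L2 M. E (\<lambda>x. indicator A x * f x) \<le> E f)"

definition irreducible_form :: "'a measure \<Rightarrow> (('a \<Rightarrow> real) \<Rightarrow> ennreal) \<Rightarrow> bool" where
  "irreducible_form M E \<longleftrightarrow>
    (\<forall>A. invariant_set M E A \<longrightarrow> emeasure M A = 0 \<or> emeasure M (space M - A) = 0)"


section \<open>The extended form\<close>

definition L0_tendsto :: "'a measure \<Rightarrow> (nat \<Rightarrow> 'a \<Rightarrow> real) \<Rightarrow> ('a \<Rightarrow> real) \<Rightarrow> bool" where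
  "L0_tendsto M u f \<longleftrightarrow>
    (\<forall>r :: nat \<Rightarrow> nat. strict_mono r \<longrightarrow>
      (\<exists>s :: nat \<Rightarrow> nat. strict_mono s \<and> (AE x in M. (\<lambda>n. u (r (s n)) x) \<longlonglongrightarrow> f x)))"

definition approximating ::
  "'a measure \<Rightarrow> (('a \<Rightarrow> real) \<Rightarrow> ennreal) \<Rightarrow> (nat \<Rightarrow> 'a \<Rightarrow> real) \<Rightarrow> ('a \<Rightarrow> real) \<Rightarrow> bool" where
  "approximating M E u f \<longleftrightarrow>
    (\<forall>n. u n \<in> form_domain M E) \<and>
    (\<forall>e>0. \<exists>N. \<forall>m\<ge>N. \<forall>n\<ge>N. E (\<lambda>x. u m x - u n x) < e) \<and>
    L0_tendsto M u f"

text \<open>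
  For a Dirichlet form the limit does not depend on the approximating sequence, so the definite
  description below denotes the common limit.
\<close>

definition extended_form ::
  "'a measure \<Rightarrow> (('a \<Rightarrow> real) \<Rightarrow> ennreal) \<Rightarrow> ('a \<Rightarrow> real) \<Rightarrow> ennreal" where
  "extended_form M E f =
    (if \<exists>u. approximating M E u f
     then (THE l. \<forall>u. approximating M E u f \<longrightarrow> (\<lambda>n. E (u n)) \<longlonglongrightarrow> l)
     else \<infinity>)"

definition ext_domain :: "'a measure \<Rightarrow> (('a \<Rightarrow> real) \<Rightarrow> ennreal) \<Rightarrow> ('a \<Rightarrow> real) set" where
  "ext_domain M E = {f \<in> borel_measurable M. extended_form M E f < \<infinity>}"

definition ext_kernel :: "'a measure \<Rightarrow> (('a \<Rightarrow> real) \<Rightarrow> ennreal) \<Rightarrow> ('a \<Rightarrow> real) set" where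
  "ext_kernel M E = {f \<in> borel_measurable M. extended_form M E f = 0}"

definition ae_constants :: "'a measure \<Rightarrow> ('a \<Rightarrow> real) set" where
  "ae_constants M = {f \<in> borel_measurable M. \<exists>c. AE x in M. f x = c}"

definition ext_bilinear ::
  "'a measure \<Rightarrow> (('a \<Rightarrow> real) \<Rightarrow> ennreal) \<Rightarrow> ('a \<Rightarrow> real) \<Rightarrow> ('a \<Rightarrow> real) \<Rightarrow> real" where
  "ext_bilinear M E f g =
    (enn2real (extended_form M E (\<lambda>x. f x + g x)) - enn2real (extended_form M E (\<lambda>x. f x - g x))) / 4"


section \<open>The quotient of the extended domain by the constants\<close>

text \<open>
  Passing from functions to a.e.-classes and dividing by the constants is done in one step.
\<close>

definition mod_const :: "'a measure \<Rightarrow> (('a \<Rightarrow> real) \<times> ('a \<Rightarrow> real)) set" where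
  "mod_const M =
    {(f, g). f \<in> borel_measurable M \<and> g \<in> borel_measurable M \<and> (\<exists>c. AE x in M. f x - g x = c)}"

definition quot_space :: "'a measure \<Rightarrow> (('a \<Rightarrow> real) \<Rightarrow> ennreal) \<Rightarrow> ('a \<Rightarrow> real) set set" where
  "quot_space M E = ext_domain M E // mod_const M"

definition quot_zero :: "'a measure \<Rightarrow> ('a \<Rightarrow> real) set" where
  "quot_zero M = mod_const M `` {\<lambda>x. 0}"

definition quot_add ::
  "'a measure \<Rightarrow> ('a \<Rightarrow> real) set \<Rightarrow> ('a \<Rightarrow> real) set \<Rightarrow> ('a \<Rightarrow> real) set" where
  "quot_add M P Q = (\<Union>f\<in>P. \<Union>g\<in>Q. mod_const M `` {\<lambda>x. f x + g x})"

definition quot_scale :: "'a measure \<Rightarrow> real \<Rightarrow> ('a \<Rightarrow> real) set \<Rightarrow> ('a \<Rightarrow> real) set" where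
  "quot_scale M c P = (\<Union>f\<in>P. mod_const M `` {\<lambda>x. c * f x})"

definition quot_inner ::
  "'a measure \<Rightarrow> (('a \<Rightarrow> real) \<Rightarrow> ennreal) \<Rightarrow> ('a \<Rightarrow> real) set \<Rightarrow> ('a \<Rightarrow> real) set \<Rightarrow> real" where
  "quot_inner M E P Q = the_elem (\<Union>f\<in>P. \<Union>g\<in>Q. {ext_bilinear M E f g})"


section \<open>Hilbert spaces on a carrier set\<close>

text \<open>
  The type class \<open>real_inner\<close> is of no use for a space that depends on a measure and a form.
\<close>

locale inner_product_space =
  fixes V :: "'v set"
    and add :: "'v \<Rightarrow> 'v \<Rightarrow> 'v"
    and zero :: 'v
    and scale :: "real \<Rightarrow> 'v \<Rightarrow> 'v"
    and inner :: "'v \<Rightarrow> 'v \<Rightarrow> real"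
  assumes zero_closed: "zero \<in> V"
    and add_closed: "\<lbrakk>x \<in> V; y \<in> V\<rbrakk> \<Longrightarrow> add x y \<in> V"
    and scale_closed: "x \<in> V \<Longrightarrow> scale a x \<in> V"
    and add_assoc: "\<lbrakk>x \<in> V; y \<in> V; z \<in> V\<rbrakk> \<Longrightarrow> add (add x y) z = add x (add y z)"
    and add_commute: "\<lbrakk>x \<in> V; y \<in> V\<rbrakk> \<Longrightarrow> add x y = add y x"
    and add_zero: "x \<in> V \<Longrightarrow> add x zero = x"
    and add_inverse: "x \<in> V \<Longrightarrow> add x (scale (-1) x) = zero"
    and scale_one: "x \<in> V \<Longrightarrow> scale 1 x = x"
    and scale_scale: "x \<in> V \<Longrightarrow> scale a (scale b x) = scale (a * b) x"
    and scale_add_left: "x \<in> V \<Longrightarrow> scale (a + b) x = add (scale a x) (scale b x)"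
    and scale_add_right: "\<lbrakk>x \<in> V; y \<in> V\<rbrakk> \<Longrightarrow> scale a (add x y) = add (scale a x) (scale a y)"
    and inner_commute: "\<lbrakk>x \<in> V; y \<in> V\<rbrakk> \<Longrightarrow> inner x y = inner y x"
    and inner_add: "\<lbrakk>x \<in> V; y \<in> V; z \<in> V\<rbrakk> \<Longrightarrow> inner (add x y) z = inner x z + inner y z"
    and inner_scale: "\<lbrakk>x \<in> V; y \<in> V\<rbrakk> \<Longrightarrow> inner (scale a x) y = a * inner x y"
    and inner_nonneg: "x \<in> V \<Longrightarrow> 0 \<le> inner x x"
    and inner_definite: "x \<in> V \<Longrightarrow> inner x x = 0 \<Longrightarrow> x = zero"

locale hilbert_space = inner_product_space +
  assumes complete:
    "complete_wrt V (\<lambda>x y. sqrt (inner (add x (scale (-1) y)) (add x (scale (-1) y))))"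

end

theory Submission
  imports Defs "HOL-Probability.Probability"
begin

text \<open>
  On the unit interval let \<open>\<sigma>\<^sub>i\<close> flip the \<open>i\<close>-th binary digit. These maps preserve Lebesgue measure and
  are jointly ergodic, so \<open>\<E>(f) = \<Sum>\<^sub>i w\<^sub>i \<integral>(f \<circ> \<sigma>\<^sub>i - f)\<^sup>2\<close> with summable weights is a bounded irreducible
  Dirichlet form. Truncation shows that \<open>\<E>\<^sub>e\<close> is given by the same formula on all measurable functions,
  so that \<open>D(\<E>\<^sub>e)\<close> modulo constants is complete only if \<open>f \<mapsto> (f \<circ> \<sigma>\<^sub>i - f)\<^sub>i\<close> has closed range in the
  weighted \<open>L\<^sup>2\<close>-space. The increments of the partial sums of \<open>\<Sum>\<^sub>i 2\<^sup>i r\<^sub>i\<close>, where \<open>r\<^sub>i\<close> are the Rademacher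
  functions, converge if \<open>w\<^sub>i\<close> is of order \<open>8\<^sup>-\<^sup>i\<close>. A limit \<open>f\<close> would satisfy \<open>\<bar>f \<circ> \<sigma>\<^sub>i - f\<bar> = 2 \<cdot> 2\<^sup>i\<close> for
  all \<open>i\<close>; then \<open>{\<bar>f\<bar> \<le> K}\<close> and its preimage under \<open>\<sigma>\<^sub>i\<close> are disjoint for large \<open>i\<close>, whence
  \<open>\<mu>(\<bar>f\<bar> \<le> K) \<le> 1/2\<close> for every \<open>K\<close>, which is absurd.
\<close>


section \<open>Square-integrable functions\<close>

lemma L2_iff_nn_integral:
  "f \<in> L2 M \<longleftrightarrow> f \<in> borel_measurable M \<and> (\<integral>\<^sup>+x. ennreal ((f x)\<^sup>2) \<partial>M) < \<infinity>"
  unfolding L2_def by (auto simp: integrable_iff_bounded)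

text \<open>Integrates \<open>(a + b)^2 \<le> 2 a^2 + 2 b^2\<close>. In what follows it takes the
  place of the Minkowski inequality and makes sense for infinite integrals as well.\<close>

lemma nn_integral_power2_add_le:
  fixes f g :: "'a \<Rightarrow> real"
  assumes [measurable]: "f \<in> borel_measurable M" "g \<in> borel_measurable M"
  shows "(\<integral>\<^sup>+x. ennreal ((f x + g x)\<^sup>2) \<partial>M)
    \<le> 2 * (\<integral>\<^sup>+x. ennreal ((f x)\<^sup>2) \<partial>M) + 2 * (\<integral>\<^sup>+x. ennreal ((g x)\<^sup>2) \<partial>M)"
proof -
  have "(\<integral>\<^sup>+x. ennreal ((f x + g x)\<^sup>2) \<partial>M) \<le> (\<integral>\<^sup>+x. 2 * ennreal ((f x)\<^sup>2) + 2 * ennreal ((g x)\<^sup>2) \<partial>M)"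
  proof (rule nn_integral_mono)
    fix x
    have "(f x + g x)\<^sup>2 \<le> 2 * (f x)\<^sup>2 + 2 * (g x)\<^sup>2"
      using zero_le_power2[of "f x - g x"] by (simp add: power2_eq_square algebra_simps)
    then have "ennreal ((f x + g x)\<^sup>2) \<le> ennreal (2 * (f x)\<^sup>2 + 2 * (g x)\<^sup>2)"
      by (rule ennreal_leI)
    then show "ennreal ((f x + g x)\<^sup>2) \<le> 2 * ennreal ((f x)\<^sup>2) + 2 * ennreal ((g x)\<^sup>2)"
      by (simp add: ennreal_plus ennreal_mult)
  qed
  also have "\<dots> = 2 * (\<integral>\<^sup>+x. ennreal ((f x)\<^sup>2) \<partial>M) + 2 * (\<integral>\<^sup>+x. ennreal ((g x)\<^sup>2) \<partial>M)"
    by (subst nn_integral_add) (auto simp: nn_integral_cmult)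
  finally show ?thesis .
qed

lemma L2_add: "f \<in> L2 M \<Longrightarrow> g \<in> L2 M \<Longrightarrow> (\<lambda>x. f x + g x) \<in> L2 M"
  unfolding L2_iff_nn_integral
  using nn_integral_power2_add_le[of f M g]
  by (auto simp: ennreal_mult_less_top ennreal_add_eq_top intro: le_less_trans)

lemma L2_scale: "f \<in> L2 M \<Longrightarrow> (\<lambda>x. c * f x) \<in> L2 M"
  unfolding L2_def by (auto simp: power_mult_distrib)

lemma L2_diff: "f \<in> L2 M \<Longrightarrow> g \<in> L2 M \<Longrightarrow> (\<lambda>x. f x - g x) \<in> L2 M"
  using L2_add[of f M "\<lambda>x. -1 * g x"] L2_scale[of g M "-1"] by simp

lemma (in finite_measure) L2_bounded:
  fixes f :: "'a \<Rightarrow> real"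
  assumes [measurable]: "f \<in> borel_measurable M" and "\<And>x. \<bar>f x\<bar> \<le> B"
  shows "f \<in> L2 M"
proof -
  have "(f x)\<^sup>2 \<le> B\<^sup>2" for x
    using assms(2)[of x] by (simp add: abs_le_square_iff[symmetric] abs_le_iff)
  then have "integrable M (\<lambda>x. (f x)\<^sup>2)"
    by (intro integrable_const_bound[where B = "B\<^sup>2"]) auto
  then show ?thesis by (simp add: L2_def)
qed

lemma nn_integral_L2_dist:
  assumes "f \<in> L2 M" "g \<in> L2 M"
  shows "(\<integral>\<^sup>+x. ennreal ((f x - g x)\<^sup>2) \<partial>M) = ennreal ((L2_dist M f g)\<^sup>2)"
proof -
  have "integrable M (\<lambda>x. (f x - g x)\<^sup>2)"
    using L2_diff[OF assms] by (simp add: L2_def)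
  then show ?thesis
    by (simp add: L2_dist_def nn_integral_eq_integral)
qed

text \<open>With \<open>a = h\<close> and \<open>b = u n - h\<close>, weighted Young gives
  \<open>|(a + b)^2 - a^2| \<le> e a^2 + (1 + 1/e) b^2\<close>. For fixed \<open>e\<close> the
  second term vanishes in the limit, and the first is as small as desired.\<close>

lemma tendsto_nn_integral_power2:
  fixes h :: "'a \<Rightarrow> real"
  assumes [measurable]: "\<And>n. u n \<in> borel_measurable M" "h \<in> borel_measurable M"
    and fin: "(\<integral>\<^sup>+x. ennreal ((h x)\<^sup>2) \<partial>M) < \<infinity>"
    and lim: "(\<lambda>n. \<integral>\<^sup>+x. ennreal ((u n x - h x)\<^sup>2) \<partial>M) \<longlonglongrightarrow> 0"
    and finu: "\<And>n. (\<integral>\<^sup>+x. ennreal ((u n x)\<^sup>2) \<partial>M) < \<infinity>"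
  shows "(\<lambda>n. \<integral>\<^sup>+x. ennreal ((u n x)\<^sup>2) \<partial>M) \<longlonglongrightarrow> (\<integral>\<^sup>+x. ennreal ((h x)\<^sup>2) \<partial>M)"
proof -
  have h: "h \<in> L2 M" and u: "u n \<in> L2 M" for n
    using fin finu by (auto simp: L2_iff_nn_integral)
  have ih: "integrable M (\<lambda>x. (h x)\<^sup>2)" and iu: "integrable M (\<lambda>x. (u n x)\<^sup>2)"
    and id: "integrable M (\<lambda>x. (u n x - h x)\<^sup>2)" for n
    using h u L2_diff[OF u h] by (auto simp: L2_def)
  define q where "q = (LINT x|M. (h x)\<^sup>2)"
  define d where "d n = (LINT x|M. (u n x - h x)\<^sup>2)" for n
  have q: "q \<ge> 0" by (simp add: q_def)
  have dlim: "d \<longlonglongrightarrow> 0"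
    using lim id by (simp add: d_def[abs_def] nn_integral_eq_integral flip: ennreal_0)
  have est: "\<bar>(LINT x|M. (u n x)\<^sup>2) - q\<bar> \<le> e * q + (1 + 1 / e) * d n" if e: "e > 0" for e n
  proof -
    have "\<bar>(LINT x|M. (u n x)\<^sup>2) - q\<bar> = \<bar>LINT x|M. (u n x)\<^sup>2 - (h x)\<^sup>2\<bar>"
      using ih iu by (simp add: q_def)
    also have "\<dots> \<le> (LINT x|M. e * (h x)\<^sup>2 + (1 + 1 / e) * (u n x - h x)\<^sup>2)"
    proof (rule integral_abs_bound[THEN order_trans], rule integral_mono)
      fix x
      define a b where "a = h x" and "b = u n x - h x"
      have ux: "u n x = a + b" and hx: "h x = a" by (auto simp: a_def b_def)
      \<comment> \<open>These two squares encode
        \<open>|2 a b| \<le> e a^2 + b^2 / e\<close>.\<close>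
      have 1: "0 \<le> (sqrt e * a - b / sqrt e)\<^sup>2" "0 \<le> (sqrt e * a + b / sqrt e)\<^sup>2" by auto
      have 2: "(sqrt e * a - b / sqrt e)\<^sup>2 = e * a\<^sup>2 + b\<^sup>2 / e - 2 * a * b"
        "(sqrt e * a + b / sqrt e)\<^sup>2 = e * a\<^sup>2 + b\<^sup>2 / e + 2 * a * b"
        using e by (simp_all add: power2_diff power2_sum power_mult_distrib power_divide)
      have "(a + b)\<^sup>2 - a\<^sup>2 = b\<^sup>2 + 2 * a * b" "(1 + 1 / e) * b\<^sup>2 = b\<^sup>2 + b\<^sup>2 / e" "0 \<le> b\<^sup>2"
        by (auto simp: power2_sum algebra_simps)
      then have "\<bar>(a + b)\<^sup>2 - a\<^sup>2\<bar> \<le> e * a\<^sup>2 + (1 + 1 / e) * b\<^sup>2"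
        using 1[unfolded 2] by linarith
      then show "\<bar>(u n x)\<^sup>2 - (h x)\<^sup>2\<bar> \<le> e * (h x)\<^sup>2 + (1 + 1 / e) * (u n x - h x)\<^sup>2"
        by (simp add: ux hx)
    qed (use ih iu id in auto)
    also have "\<dots> = e * q + (1 + 1 / e) * d n"
      using ih id[of n] by (simp add: q_def d_def)
    finally show ?thesis .
  qed
  have "(\<lambda>n. LINT x|M. (u n x)\<^sup>2) \<longlonglongrightarrow> q"
  proof (rule LIMSEQ_I)
    fix r :: real assume r: "r > 0"
    \<comment> \<open>Makes \<open>e * q\<close> smaller than \<open>r / 2\<close>; the summand 1
      covers the case \<open>q = 0\<close>.\<close>
    define e where "e = r / (2 * (q + 1))"
    have e: "e > 0" using r q by (simp add: e_def)
    have eq: "e * q < r / 2"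
      using r q by (simp add: e_def field_simps)
    have "(\<lambda>n. (1 + 1 / e) * d n) \<longlonglongrightarrow> (1 + 1 / e) * 0"
      by (intro tendsto_intros dlim)
    then have "\<forall>\<^sub>F n in sequentially. (1 + 1 / e) * d n < r / 2"
      using r by (intro order_tendstoD) auto
    then obtain n0 where n0: "\<And>n. n \<ge> n0 \<Longrightarrow> (1 + 1 / e) * d n < r / 2"
      by (auto simp: eventually_sequentially)
    show "\<exists>no. \<forall>n\<ge>no. norm ((LINT x|M. (u n x)\<^sup>2) - q) < r"
      using est[OF e] eq n0 by (intro exI[of _ n0]) (smt (verit) real_norm_def field_sum_of_halves)
  qed
  then show ?thesis
    using ih iu by (simp add: q_def nn_integral_eq_integral)
qed

section \<open>Completeness of \<open>L2\<close> over a probability space\<close>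

lemma (in prob_space) L1_le_L2_dist:
  assumes "f \<in> L2 M" "g \<in> L2 M"
  shows "(LINT x|M. \<bar>f x - g x\<bar>) \<le> L2_dist M f g"
proof -
  have [measurable]: "f \<in> borel_measurable M" "g \<in> borel_measurable M"
    using assms by (auto simp: L2_def)
  have i2: "integrable M (\<lambda>x. (f x - g x)\<^sup>2)"
    using L2_diff[OF assms] by (simp add: L2_def)
  then have i1: "integrable M (\<lambda>x. f x - g x)"
    by (rule square_integrable_imp_integrable[rotated]) simp
  \<comment> \<open>This is the nonnegativity of the variance of \<open>|f - g|\<close>.\<close>
  have "(LINT x|M. \<bar>f x - g x\<bar>)\<^sup>2 \<le> (LINT x|M. \<bar>f x - g x\<bar>\<^sup>2)"
    using i1 i2 variance_positive[of "\<lambda>x. \<bar>f x - g x\<bar>"]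
    by (subst (asm) variance_eq) auto
  then show ?thesis
    by (simp add: L2_dist_def real_le_rsqrt)
qed

text \<open>Riesz-Fischer: an \<open>L2\<close>-Cauchy sequence is \<open>L1\<close>-Cauchy, hence
  has a subsequence converging a.e., and Fatou shows that its limit is also the
  \<open>L2\<close>-limit of the whole sequence.\<close>

lemma (in prob_space) L2_complete:
  assumes u: "\<And>n::nat. u n \<in> L2 M"
    and cauchy: "\<And>e. e > 0 \<Longrightarrow> \<exists>N. \<forall>m\<ge>N. \<forall>n\<ge>N. L2_dist M (u m) (u n) < e"
  obtains f where "f \<in> L2 M" "(\<lambda>n. L2_dist M (u n) f) \<longlonglongrightarrow> 0"
proof -
  have [measurable]: "u n \<in> borel_measurable M" for n using u by (auto simp: L2_def)
  have iu: "integrable M (u n)" for n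
    using u[of n] by (rule_tac square_integrable_imp_integrable) (auto simp: L2_def)
  have "\<exists>N. \<forall>m\<ge>N. \<forall>n\<ge>N. (LINT x|M. norm (u m x - u n x)) < e" if "e > 0" for e
    using cauchy[OF that] order_le_less_trans[OF L1_le_L2_dist[OF u u]] by fastforce
  from cauchy_L1_AE_cauchy_subseq[OF iu this]
  obtain r where r: "strict_mono r" and Cr: "AE x in M. Cauchy (\<lambda>i. u (r i) x)" by blast
  define f where "f x = lim (\<lambda>i. u (r i) x)" for x
  have [measurable]: "f \<in> borel_measurable M" unfolding f_def by measurable
  have lim: "AE x in M. (\<lambda>i. u (r i) x) \<longlonglongrightarrow> f x"
    using Cr by eventually_elim (simp add: f_def Cauchy_convergent_iff convergent_LIMSEQ_iff)
  have fatou: "(\<integral>\<^sup>+x. ennreal ((u m x - f x)\<^sup>2) \<partial>M) \<le> ennreal (e\<^sup>2)"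
    if N: "\<And>n. n \<ge> N \<Longrightarrow> L2_dist M (u m) (u n) < e" for N m e
  proof -
    have "(\<integral>\<^sup>+x. ennreal ((u m x - f x)\<^sup>2) \<partial>M)
        = (\<integral>\<^sup>+x. liminf (\<lambda>i. ennreal ((u m x - u (r i) x)\<^sup>2)) \<partial>M)"
    proof (rule nn_integral_cong_AE)
      show "AE x in M. ennreal ((u m x - f x)\<^sup>2) = liminf (\<lambda>i. ennreal ((u m x - u (r i) x)\<^sup>2))"
        using lim
      proof eventually_elim
        case (elim x)
        then have "(\<lambda>i. ennreal ((u m x - u (r i) x)\<^sup>2)) \<longlonglongrightarrow> ennreal ((u m x - f x)\<^sup>2)"
          by (intro tendsto_ennrealI tendsto_intros)
        from lim_imp_Liminf[OF _ this] show ?case by simp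
      qed
    qed
    also have "\<dots> \<le> liminf (\<lambda>i. \<integral>\<^sup>+x. ennreal ((u m x - u (r i) x)\<^sup>2) \<partial>M)"
      by (intro nn_integral_liminf) auto
    also have "\<dots> \<le> ennreal (e\<^sup>2)"
    proof (rule Liminf_le)
      show "\<forall>\<^sub>F i in sequentially. (\<integral>\<^sup>+x. ennreal ((u m x - u (r i) x)\<^sup>2) \<partial>M) \<le> ennreal (e\<^sup>2)"
        using eventually_ge_at_top[of N]
      proof eventually_elim
        case (elim i)
        then have "L2_dist M (u m) (u (r i)) < e"
          using N seq_suble[OF r, of i] by auto
        moreover have "0 \<le> L2_dist M (u m) (u (r i))" by (simp add: L2_dist_def)
        ultimately show ?case
          by (simp add: nn_integral_L2_dist[OF u u] ennreal_leI power_mono)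
      qed
    qed simp
    finally show ?thesis .
  qed
  obtain N where "\<And>n. n \<ge> N \<Longrightarrow> L2_dist M (u N) (u n) < 1" using cauchy[of 1] by auto
  then have "(\<lambda>x. u N x - f x) \<in> L2 M"
    using fatou[of N N 1] by (auto simp: L2_iff_nn_integral intro: le_less_trans)
  from L2_diff[OF u this, of N] have f: "f \<in> L2 M" by simp
  have "(\<lambda>n. L2_dist M (u n) f) \<longlonglongrightarrow> 0"
  proof (rule LIMSEQ_I)
    fix e :: real assume e: "e > 0"
    \<comment> \<open>Fatou turns strict bounds into weak ones, so half of \<open>e\<close> is used
      to end with a strict bound.\<close>
    then obtain N where N: "\<And>m n. m \<ge> N \<Longrightarrow> n \<ge> N \<Longrightarrow> L2_dist M (u m) (u n) < e / 2"
      using cauchy[of "e / 2"] by auto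
    have "L2_dist M (u m) f < e" if "m \<ge> N" for m
    proof -
      have "(L2_dist M (u m) f)\<^sup>2 \<le> (e / 2)\<^sup>2"
        using fatou[OF N[OF that], of N] by (simp add: nn_integral_L2_dist[OF u f])
      then have "L2_dist M (u m) f \<le> e / 2" by (rule power2_le_imp_le) (use e in simp)
      then show ?thesis using e by simp
    qed
    then show "\<exists>no. \<forall>n\<ge>no. norm (L2_dist M (u n) f - 0) < e"
      by (auto intro!: exI[of _ N] simp: L2_dist_def)
  qed
  with f that show ?thesis by blast
qed

section \<open>Jump forms\<close>

text \<open>\<open>N\<close> is the law of a random jump from \<open>P z\<close> to \<open>S z\<close>.\<close>

locale jump_form = M: prob_space M + N: prob_space N
  for M :: "'a measure" and N :: "'b measure" +
  fixes S P :: "'b \<Rightarrow> 'a"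
  assumes S_measurable [measurable]: "S \<in> measurable N M"
    and P_measurable [measurable]: "P \<in> measurable N M"
    and distr_S: "distr N M S = M"
    and distr_P: "distr N M P = M"
    and ergodic: "\<lbrakk>f \<in> borel_measurable M; AE z in N. f (S z) = f (P z)\<rbrakk>
      \<Longrightarrow> \<exists>c::real. AE x in M. f x = c"
begin

section \<open>Increments and the energy they define\<close>

definition D :: "('a \<Rightarrow> real) \<Rightarrow> 'b \<Rightarrow> real" where
  "D f z = f (S z) - f (P z)"

text \<open>The formula is read on all measurable functions, not only on \<open>L2\<close>, because
  \<open>E\<close> itself turns out to be its extended form.\<close>

definition E :: "('a \<Rightarrow> real) \<Rightarrow> ennreal" where
  "E f = (\<integral>\<^sup>+z. ennreal ((D f z)\<^sup>2) \<partial>N)"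

lemma D_measurable [measurable (raw)]:
  assumes [measurable]: "f \<in> borel_measurable M"
  shows "D f \<in> borel_measurable N"
  unfolding D_def[abs_def] by measurable

lemma D_add: "D (\<lambda>x. f x + g x) z = D f z + D g z"
  and D_diff: "D (\<lambda>x. f x - g x) z = D f z - D g z"
  and D_scale: "D (\<lambda>x. c * f x) z = c * D f z"
  and D_const: "D (\<lambda>x. c) z = 0"
  by (auto simp: D_def algebra_simps)

text \<open>\<open>S\<close> and \<open>P\<close> push \<open>N\<close> forward to \<open>M\<close>,
  so preimages of null sets are null. Hence increments are well defined on a.e.-classes.\<close>

lemma AE_S: "AE x in M. Q x \<Longrightarrow> AE z in N. Q (S z)"
  and AE_P: "AE x in M. Q x \<Longrightarrow> AE z in N. Q (P z)"
proof -
  show "AE z in N. Q (S z)" if "AE x in M. Q x"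
    using that by (intro AE_distrD[OF S_measurable]) (simp only: distr_S)
  show "AE z in N. Q (P z)" if "AE x in M. Q x"
    using that by (intro AE_distrD[OF P_measurable]) (simp only: distr_P)
qed

lemma AE_D_cong:
  assumes "AE x in M. f x = g x"
  shows "AE z in N. D f z = D g z"
  using AE_S[OF assms] AE_P[OF assms] by eventually_elim (simp add: D_def)

lemma E_cong_AE: "AE x in M. f x = g x \<Longrightarrow> E f = E g"
  unfolding E_def by (rule nn_integral_cong_AE) (use AE_D_cong in fastforce)

lemma E_add_const:
  assumes "AE x in M. f x - g x = c"
  shows "E f = E g"
proof -
  have "E f = E (\<lambda>x. g x + c)"
    by (rule E_cong_AE) (use assms in eventually_elim, simp)
  then show ?thesis by (simp add: E_def D_add D_const)
qed

lemma E_scale: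
  assumes [measurable]: "f \<in> borel_measurable M"
  shows "E (\<lambda>x. c * f x) = ennreal (c\<^sup>2) * E f"
  by (simp add: E_def D_scale power_mult_distrib ennreal_mult nn_integral_cmult)

lemma E_diff_commute: "E (\<lambda>x. f x - g x) = E (\<lambda>x. g x - f x)"
  by (simp add: E_def D_diff power2_commute)

lemma E_parallelogram:
  assumes [measurable]: "f \<in> borel_measurable M" "g \<in> borel_measurable M"
  shows "E (\<lambda>x. f x + g x) + E (\<lambda>x. f x - g x) = 2 * E f + 2 * E g"
proof -
  have "E (\<lambda>x. f x + g x) + E (\<lambda>x. f x - g x)
      = (\<integral>\<^sup>+z. ennreal ((D f z + D g z)\<^sup>2) + ennreal ((D f z - D g z)\<^sup>2) \<partial>N)"
    by (simp add: E_def D_add D_diff nn_integral_add)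
  also have "\<dots> = (\<integral>\<^sup>+z. 2 * ennreal ((D f z)\<^sup>2) + 2 * ennreal ((D g z)\<^sup>2) \<partial>N)"
  proof (rule nn_integral_cong)
    fix z
    have "(D f z + D g z)\<^sup>2 + (D f z - D g z)\<^sup>2 = 2 * (D f z)\<^sup>2 + 2 * (D g z)\<^sup>2"
      by (simp add: power2_eq_square algebra_simps)
    then have "ennreal ((D f z + D g z)\<^sup>2 + (D f z - D g z)\<^sup>2) = ennreal (2 * (D f z)\<^sup>2 + 2 * (D g z)\<^sup>2)"
      by simp
    then show "ennreal ((D f z + D g z)\<^sup>2) + ennreal ((D f z - D g z)\<^sup>2)
        = 2 * ennreal ((D f z)\<^sup>2) + 2 * ennreal ((D g z)\<^sup>2)"
      by (simp add: ennreal_plus ennreal_mult)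
  qed
  also have "\<dots> = 2 * E f + 2 * E g"
    by (subst nn_integral_add) (auto simp: nn_integral_cmult E_def)
  finally show ?thesis .
qed

lemma E_add_le:
  assumes [measurable]: "f \<in> borel_measurable M" "g \<in> borel_measurable M"
  shows "E (\<lambda>x. f x + g x) \<le> 2 * E f + 2 * E g"
  using nn_integral_power2_add_le[of "D f" N "D g"] by (simp add: E_def D_add)

lemma E_diff_le:
  assumes [measurable]: "f \<in> borel_measurable M" "g \<in> borel_measurable M"
  shows "E (\<lambda>x. f x - g x) \<le> 2 * E f + 2 * E g"
  using E_parallelogram[OF assms] by (metis add.commute le_iff_add)

lemma E_triangle:
  assumes [measurable]: "f \<in> borel_measurable M" "g \<in> borel_measurable M" "h \<in> borel_measurable M"
  shows "E (\<lambda>x. f x - h x) \<le> 2 * E (\<lambda>x. f x - g x) + 2 * E (\<lambda>x. g x - h x)"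
  using E_add_le[of "\<lambda>x. f x - g x" "\<lambda>x. g x - h x"] by simp

section \<open>Boundedness on \<open>L2\<close> and the axioms of a Dirichlet form\<close>

lemma E_le_L2:
  assumes [measurable]: "f \<in> borel_measurable M"
  shows "E f \<le> 4 * (\<integral>\<^sup>+x. ennreal ((f x)\<^sup>2) \<partial>M)"
proof -
  \<comment> \<open>Composition with a measure-preserving map is isometric, so each endpoint of the
    jump contributes the full \<open>L2\<close>-norm.\<close>
  have S: "(\<integral>\<^sup>+z. ennreal ((f (S z))\<^sup>2) \<partial>N) = (\<integral>\<^sup>+x. ennreal ((f x)\<^sup>2) \<partial>M)"
    using nn_integral_distr[of S N M "\<lambda>x. ennreal ((f x)\<^sup>2)"] by (simp add: distr_S)
  have P: "(\<integral>\<^sup>+z. ennreal ((f (P z))\<^sup>2) \<partial>N) = (\<integral>\<^sup>+x. ennreal ((f x)\<^sup>2) \<partial>M)"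
    using nn_integral_distr[of P N M "\<lambda>x. ennreal ((f x)\<^sup>2)"] by (simp add: distr_P)
  have "E f \<le> 2 * (\<integral>\<^sup>+z. ennreal ((f (S z))\<^sup>2) \<partial>N) + 2 * (\<integral>\<^sup>+z. ennreal ((f (P z))\<^sup>2) \<partial>N)"
    using nn_integral_power2_add_le[of "\<lambda>z. f (S z)" N "\<lambda>z. - f (P z)"]
    by (simp add: E_def D_def)
  also have "\<dots> = 4 * (\<integral>\<^sup>+x. ennreal ((f x)\<^sup>2) \<partial>M)"
    by (simp add: S P flip: distrib_right)
  finally show ?thesis .
qed

lemma form_domain_E: "form_domain M E = L2 M"
  by (auto simp: form_domain_def L2_iff_nn_integral ennreal_mult_less_top
      intro!: le_less_trans[OF E_le_L2])

lemma quadratic_form_E: "quadratic_form M E"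
  unfolding quadratic_form_def
  by (auto intro: E_cong_AE E_scale E_parallelogram simp: L2_def)

text \<open>As \<open>E\<close> is bounded by the \<open>L2\<close>-norm, the form distance is
  controlled by the \<open>L2\<close>-distance, and closedness reduces to completeness of
  \<open>L2\<close>.\<close>

lemma closed_form_E: "closed_form M E"
  unfolding closed_form_def complete_wrt_def form_domain_E
proof (intro allI impI, elim conjE)
  fix u :: "nat \<Rightarrow> 'a \<Rightarrow> real"
  assume u: "\<forall>n. u n \<in> L2 M"
    and cauchy: "\<forall>e>0. \<exists>N. \<forall>m\<ge>N. \<forall>n\<ge>N.
      sqrt (enn2real (E (\<lambda>x. u m x - u n x))) + L2_dist M (u m) (u n) < e"
  have "\<exists>N. \<forall>m\<ge>N. \<forall>n\<ge>N. L2_dist M (u m) (u n) < e" if "e > 0" for e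
    using cauchy[rule_format, OF that]
    by (elim ex_forward all_forward imp_forward) (auto simp: add_increasing intro: le_less_trans[rotated])
  with u obtain f where f: "f \<in> L2 M" and lim: "(\<lambda>n. L2_dist M (u n) f) \<longlonglongrightarrow> 0"
    using M.L2_complete by blast
  have bound: "sqrt (enn2real (E (\<lambda>x. u n x - f x))) \<le> 2 * L2_dist M (u n) f" for n
  proof (rule real_le_lsqrt)
    have d: "L2_dist M (u n) f \<ge> 0" by (simp add: L2_dist_def)
    have "E (\<lambda>x. u n x - f x) \<le> 4 * (\<integral>\<^sup>+x. ennreal ((u n x - f x)\<^sup>2) \<partial>M)"
      using L2_diff[OF u[rule_format, of n] f] by (intro E_le_L2) (auto simp: L2_def)
    also have "\<dots> = ennreal ((2 * L2_dist M (u n) f)\<^sup>2)"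
      using u f d by (simp add: nn_integral_L2_dist power_mult_distrib ennreal_mult)
    finally show "enn2real (E (\<lambda>x. u n x - f x)) \<le> (2 * L2_dist M (u n) f)\<^sup>2"
      by (simp add: enn2real_leI)
    show "0 \<le> 2 * L2_dist M (u n) f" using d by simp
  qed
  have "(\<lambda>n. sqrt (enn2real (E (\<lambda>x. u n x - f x))) + L2_dist M (u n) f) \<longlonglongrightarrow> 0"
  proof (rule tendsto_sandwich[of "\<lambda>_. 0" _ _ "\<lambda>n. 3 * L2_dist M (u n) f"])
    show "(\<lambda>n. 3 * L2_dist M (u n) f) \<longlonglongrightarrow> 0"
      using tendsto_mult_left[OF lim, of 3] by simp
    show "\<forall>\<^sub>F n in sequentially.
        sqrt (enn2real (E (\<lambda>x. u n x - f x))) + L2_dist M (u n) f \<le> 3 * L2_dist M (u n) f"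
    proof (rule always_eventually, rule allI)
      show "sqrt (enn2real (E (\<lambda>x. u n x - f x))) + L2_dist M (u n) f \<le> 3 * L2_dist M (u n) f" for n
        using bound[of n] by linarith
    qed
  qed (auto simp: L2_dist_def)
  with f show "\<exists>x\<in>L2 M. (\<lambda>n. sqrt (enn2real (E (\<lambda>y. u n y - x y))) + L2_dist M (u n) x) \<longlonglongrightarrow> 0"
    by blast
qed

text \<open>A 1-Lipschitz map shrinks every increment pointwise.\<close>

lemma E_contraction:
  assumes "\<And>s t. \<bar>\<phi> s - \<phi> t\<bar> \<le> \<bar>s - t\<bar>"
  shows "E (\<lambda>x. \<phi> (f x)) \<le> E f"
  unfolding E_def D_def
  by (intro nn_integral_mono ennreal_leI) (simp add: assms abs_le_square_iff[symmetric])

lemma dirichlet_form_E: "dirichlet_form M E"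
  unfolding dirichlet_form_def
proof (intro conjI ballI)
  \<comment> \<open>The domain is all of \<open>L2\<close>, so each function approximates
    itself.\<close>
  show "densely_defined M E"
    unfolding densely_defined_def form_domain_E
    by (auto intro!: bexI simp: L2_dist_def)
  show "E (\<lambda>x. \<bar>f x\<bar>) \<le> E f" for f by (rule E_contraction) linarith
  show "E (\<lambda>x. min (f x) 1) \<le> E f" for f by (rule E_contraction) linarith
qed (rule quadratic_form_E closed_form_E)+

section \<open>Kernel and irreducibility, both from ergodicity\<close>

lemma E_eq_0_iff:
  assumes [measurable]: "f \<in> borel_measurable M"
  shows "E f = 0 \<longleftrightarrow> (\<exists>c. AE x in M. f x = c)"
proof
  assume "E f = 0"
  then have "AE z in N. f (S z) = f (P z)"
    unfolding E_def by (subst (asm) nn_integral_0_iff_AE) (auto simp: D_def)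
  then show "\<exists>c. AE x in M. f x = c" using ergodic by simp
next
  assume "\<exists>c. AE x in M. f x = c"
  then obtain c where "AE x in M. f x = c" ..
  then have "E f = E (\<lambda>x. c)" by (rule E_cong_AE)
  then show "E f = 0" by (simp add: E_def D_const)
qed

text \<open>Testing invariance of \<open>A\<close> on the constant 1, whose energy is 0, gives the
  indicator of \<open>A\<close> energy 0. It is therefore a.e. constant.\<close>

lemma irreducible_form_E: "irreducible_form M E"
  unfolding irreducible_form_def invariant_set_def
proof (intro allI impI, elim conjE)
  fix A assume A [measurable]: "A \<in> sets M" and inv: "\<forall>f\<in>L2 M. E (\<lambda>x. indicator A x * f x) \<le> E f"
  have "(\<lambda>x. 1) \<in> L2 M" by (rule M.L2_bounded[where B = 1]) auto
  from bspec[OF inv this] have "E (indicator A) = 0" by (simp add: E_def D_const)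
  then obtain c where c: "AE x in M. indicator A x = (c::real)"
    by (subst (asm) E_eq_0_iff) auto
  show "emeasure M A = 0 \<or> emeasure M (space M - A) = 0"
  proof (cases "c = 1")
    case True
    from c have "AE x in M. x \<notin> space M - A"
      by eventually_elim (use True in \<open>auto simp: indicator_def split: if_splits\<close>)
    then have "space M - A \<in> null_sets M"
      using A by (subst AE_iff_null_sets) auto
    then show ?thesis by auto
  next
    case False
    from c have "AE x in M. x \<notin> A"
      by eventually_elim (use False in \<open>auto simp: indicator_def split: if_splits\<close>)
    then have "A \<in> null_sets M"
      using A by (subst AE_iff_null_sets) auto
    then show ?thesis by auto
  qed
qed

section \<open>The extended form of a jump form\<close>

lemma tendsto_E:
  assumes [measurable]: "\<And>n. u n \<in> borel_measurable M" "f \<in> borel_measurable M"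
    and "E f < \<infinity>" "\<And>n. E (u n) < \<infinity>" "(\<lambda>n. E (\<lambda>x. u n x - f x)) \<longlonglongrightarrow> 0"
  shows "(\<lambda>n. E (u n)) \<longlonglongrightarrow> E f"
  using assms(3-) unfolding E_def D_diff
  by (intro tendsto_nn_integral_power2) auto

text \<open>Lower semicontinuity: a.e. convergence transfers to both endpoints of the jump, so the
  increments converge \<open>N\<close>-a.e. and Fatou applies.\<close>

lemma E_diff_le_of_AE_tendsto:
  assumes [measurable]: "\<And>n. v n \<in> borel_measurable M" "f \<in> borel_measurable M" "g \<in> borel_measurable M"
    and lim: "AE x in M. (\<lambda>n. v n x) \<longlonglongrightarrow> f x"
    and le: "\<forall>\<^sub>F n in sequentially. E (\<lambda>x. g x - v n x) \<le> e"
  shows "E (\<lambda>x. g x - f x) \<le> e"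
proof -
  have "E (\<lambda>x. g x - f x) = (\<integral>\<^sup>+z. liminf (\<lambda>n. ennreal ((D (\<lambda>x. g x - v n x) z)\<^sup>2)) \<partial>N)"
    unfolding E_def
  proof (rule nn_integral_cong_AE)
    show "AE z in N. ennreal ((D (\<lambda>x. g x - f x) z)\<^sup>2)
        = liminf (\<lambda>n. ennreal ((D (\<lambda>x. g x - v n x) z)\<^sup>2))"
      using AE_S[OF lim] AE_P[OF lim]
    proof eventually_elim
      case (elim z)
      then have "(\<lambda>n. ennreal ((D (\<lambda>x. g x - v n x) z)\<^sup>2)) \<longlonglongrightarrow> ennreal ((D (\<lambda>x. g x - f x) z)\<^sup>2)"
        unfolding D_def by (intro tendsto_ennrealI tendsto_intros)
      from lim_imp_Liminf[OF _ this] show ?case by simp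
    qed
  qed
  also have "\<dots> \<le> liminf (\<lambda>n. E (\<lambda>x. g x - v n x))"
    unfolding E_def by (intro nn_integral_liminf) auto
  also have "\<dots> \<le> e"
    using le by (intro Liminf_le) auto
  finally show ?thesis .
qed

text \<open>Lower semicontinuity turns the \<open>E\<close>-Cauchy property into
  \<open>E (u n - f)\<close> tending to 0. The limit of the energies thus depends on
  \<open>f\<close> only, which makes the extended form well defined.\<close>

lemma approximating_imp_tendsto:
  assumes [measurable]: "f \<in> borel_measurable M" and "approximating M E u f"
  shows "E f < \<infinity>" "(\<lambda>n. E (u n)) \<longlonglongrightarrow> E f"
proof -
  from assms(2) have u: "u n \<in> L2 M"
    and cauchy: "\<And>e. e > 0 \<Longrightarrow> \<exists>N. \<forall>m\<ge>N. \<forall>n\<ge>N. E (\<lambda>x. u m x - u n x) < e"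
    and L0: "L0_tendsto M u f" for n
    by (auto simp: approximating_def form_domain_E)
  have um [measurable]: "u n \<in> borel_measurable M" for n using u by (auto simp: L2_def)
  have finu: "E (u n) < \<infinity>" for n
    using u[of n] unfolding form_domain_E[symmetric] by (simp add: form_domain_def)
  obtain s :: "nat \<Rightarrow> nat" where s: "strict_mono s" and lim: "AE x in M. (\<lambda>n. u (s n) x) \<longlonglongrightarrow> f x"
    using L0[unfolded L0_tendsto_def, rule_format, OF strict_mono_id] by auto
  have le: "E (\<lambda>x. u m x - f x) \<le> e"
    if "\<And>n. n \<ge> N \<Longrightarrow> E (\<lambda>x. u m x - u n x) < e" for m N e
  proof (rule E_diff_le_of_AE_tendsto[OF _ _ _ lim])
    show "\<forall>\<^sub>F n in sequentially. E (\<lambda>x. u m x - u (s n) x) \<le> e"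
      using eventually_ge_at_top[of N]
      by eventually_elim (use that seq_suble[OF s] in \<open>meson less_imp_le order_trans\<close>)
  qed auto
  obtain N where N: "\<And>n. n \<ge> N \<Longrightarrow> E (\<lambda>x. u N x - u n x) < 1"
    using cauchy[of 1] by auto
  have "E f \<le> 2 * E (u N) + 2 * E (\<lambda>x. u N x - f x)"
    using E_diff_le[of "u N" "\<lambda>x. u N x - f x"] by simp
  also have "\<dots> < \<infinity>"
    using finu[of N] le_less_trans[OF le[OF N], of N \<infinity>] by (auto simp: ennreal_mult_less_top)
  finally show fin: "E f < \<infinity>" .
  have "(\<lambda>n. E (\<lambda>x. u n x - f x)) \<longlonglongrightarrow> 0"
  proof (rule order_tendstoI)
    fix e :: ennreal assume "0 < e"
    \<comment> \<open>Room for the weak inequality that lower semicontinuity leaves.\<close>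
    then obtain e' where e': "0 < e'" "e' < e" using dense by blast
    then obtain N where "\<And>m n. m \<ge> N \<Longrightarrow> n \<ge> N \<Longrightarrow> E (\<lambda>x. u m x - u n x) < e'"
      using cauchy[OF e'(1)] by blast
    then have "E (\<lambda>x. u m x - f x) < e" if "m \<ge> N" for m
      using le[of N m e'] that e'(2) by (blast intro: le_less_trans)
    then show "\<forall>\<^sub>F n in sequentially. E (\<lambda>x. u n x - f x) < e"
      by (auto simp: eventually_sequentially)
  qed auto
  with finu fin show "(\<lambda>n. E (u n)) \<longlonglongrightarrow> E f"
    by (intro tendsto_E) auto
qed

section \<open>Identification of the extended form by truncation\<close>

lemma E_truncation_tendsto:
  assumes [measurable]: "f \<in> borel_measurable M" and fin: "E f < \<infinity>"
  shows "(\<lambda>n::nat. E (\<lambda>x. max (- real n) (min (real n) (f x)) - f x)) \<longlonglongrightarrow> 0"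
proof -
  define \<phi> where "\<phi> n t = max (- real n) (min (real n) t) - t" for n t
  have [measurable]: "\<phi> n \<in> borel_measurable borel" for n unfolding \<phi>_def[abs_def] by measurable
  have "(\<lambda>n. \<integral>\<^sup>+z. ennreal ((D (\<lambda>x. \<phi> n (f x)) z)\<^sup>2) \<partial>N) \<longlonglongrightarrow> (\<integral>\<^sup>+z. 0 \<partial>N)"
  proof (rule nn_integral_dominated_convergence[where w = "\<lambda>z. ennreal ((D f z)\<^sup>2)"])
    show "AE z in N. ennreal ((D (\<lambda>x. \<phi> n (f x)) z)\<^sup>2) \<le> ennreal ((D f z)\<^sup>2)" for n
    proof (rule AE_I2)
      fix z
      \<comment> \<open>The truncation error has slopes 0 and -1 only, so its increments are
        dominated by those of \<open>f\<close>.\<close>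
      have "\<bar>\<phi> n s - \<phi> n t\<bar> \<le> \<bar>s - t\<bar>" for s t
        unfolding \<phi>_def by linarith
      then show "ennreal ((D (\<lambda>x. \<phi> n (f x)) z)\<^sup>2) \<le> ennreal ((D f z)\<^sup>2)"
        unfolding D_def by (intro ennreal_leI) (simp add: abs_le_square_iff[symmetric])
    qed
    show "AE z in N. (\<lambda>n. ennreal ((D (\<lambda>x. \<phi> n (f x)) z)\<^sup>2)) \<longlonglongrightarrow> 0"
    proof (rule AE_I2)
      fix z
      have "\<forall>\<^sub>F n in sequentially. \<phi> n t = 0" for t
        using eventually_ge_at_top[of "nat \<lceil>\<bar>t\<bar>\<rceil>"]
      proof eventually_elim
        case (elim n)
        then have "\<bar>t\<bar> \<le> real n" by linarith
        then show ?case by (simp add: \<phi>_def)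
      qed
      then have "\<forall>\<^sub>F n in sequentially. \<phi> n (f (S z)) = 0 \<and> \<phi> n (f (P z)) = 0"
        by (simp add: eventually_conj)
      then have "\<forall>\<^sub>F n in sequentially. ennreal ((D (\<lambda>x. \<phi> n (f x)) z)\<^sup>2) = 0"
        by eventually_elim (simp add: D_def)
      then show "(\<lambda>n. ennreal ((D (\<lambda>x. \<phi> n (f x)) z)\<^sup>2)) \<longlonglongrightarrow> 0"
        by (rule tendsto_eventually)
    qed
  qed (use fin in \<open>auto simp: E_def\<close>)
  then show ?thesis by (simp add: E_def \<phi>_def)
qed

text \<open>Truncations are bounded, hence in \<open>L2\<close>, and eventually equal
  \<open>f\<close> at each point. Finite energy therefore suffices to lie in the extended
  domain.\<close>

lemma approximating_truncation:
  assumes [measurable]: "f \<in> borel_measurable M" and fin: "E f < \<infinity>"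
  shows "approximating M E (\<lambda>n x. max (- real n) (min (real n) (f x))) f"
  unfolding approximating_def form_domain_E
proof (intro conjI allI impI)
  let ?u = "\<lambda>n::nat. \<lambda>x. max (- real n) (min (real n) (f x))"
  show "?u n \<in> L2 M" for n
  proof (rule M.L2_bounded[where B = "real n"])
    show "\<bar>?u n x\<bar> \<le> real n" for x by linarith
  qed simp
  show "\<exists>N. \<forall>m\<ge>N. \<forall>n\<ge>N. E (\<lambda>x. ?u m x - ?u n x) < e" if "e > 0" for e
  proof -
    have "(\<lambda>n. 4 * E (\<lambda>x. ?u n x - f x)) \<longlonglongrightarrow> 4 * 0"
      by (intro ennreal_tendsto_cmult E_truncation_tendsto fin) auto
    then have "\<forall>\<^sub>F n in sequentially. 4 * E (\<lambda>x. ?u n x - f x) < e"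
      using that by (intro order_tendstoD(2)[where y = 0]) auto
    then obtain N where N: "\<And>n. n \<ge> N \<Longrightarrow> 4 * E (\<lambda>x. ?u n x - f x) < e"
      by (auto simp: eventually_sequentially)
    have "E (\<lambda>x. ?u m x - ?u n x) < e" if "m \<ge> N" "n \<ge> N" for m n
    proof -
      have "E (\<lambda>x. ?u m x - ?u n x) \<le> 2 * E (\<lambda>x. ?u m x - f x) + 2 * E (\<lambda>x. ?u n x - f x)"
        using E_triangle[of "?u m" f "?u n"] by (simp add: E_diff_commute[of f])
      also have "\<dots> \<le> 4 * max (E (\<lambda>x. ?u m x - f x)) (E (\<lambda>x. ?u n x - f x))"
      proof -
        have "4 * c = 2 * c + 2 * (c::ennreal)" for c by (simp flip: distrib_right)
        then show ?thesis by (auto intro!: add_mono mult_left_mono)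
      qed
      also have "\<dots> < e" using N[OF that(1)] N[OF that(2)] by (auto simp: max_def)
      finally show ?thesis .
    qed
    then show ?thesis by blast
  qed
  show "L0_tendsto M ?u f"
    unfolding L0_tendsto_def
  proof (intro allI impI)
    fix r :: "nat \<Rightarrow> nat" assume r: "strict_mono r"
    have "(\<lambda>n. ?u n x) \<longlonglongrightarrow> f x" for x
    proof (rule tendsto_eventually)
      show "\<forall>\<^sub>F n in sequentially. ?u n x = f x"
        using eventually_ge_at_top[of "nat \<lceil>\<bar>f x\<bar>\<rceil>"]
      proof eventually_elim
        case (elim n)
        then have "\<bar>f x\<bar> \<le> real n" by linarith
        then show ?case by auto
      qed
    qed
    from LIMSEQ_subseq_LIMSEQ[OF this r] 
    show "\<exists>s. strict_mono s \<and> (AE x in M. (\<lambda>n. ?u (r (s n)) x) \<longlonglongrightarrow> f x)"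
      by (intro exI[of _ id]) (auto simp: strict_mono_id o_def)
  qed
qed

lemma extended_form_E:
  assumes f: "f \<in> borel_measurable M"
  shows "extended_form M E f = E f"
proof (cases "\<exists>u. approximating M E u f")
  case True
  then obtain u where u: "approximating M E u f" ..
  \<comment> \<open>The existing sequence \<open>u\<close> makes the described value unique, as
    limits in \<open>ennreal\<close> are unique.\<close>
  have "(THE l. \<forall>u. approximating M E u f \<longrightarrow> (\<lambda>n. E (u n)) \<longlonglongrightarrow> l) = E f"
    using u approximating_imp_tendsto(2)[OF f]
    by (intro the_equality) (auto intro: LIMSEQ_unique)
  with True show ?thesis by (simp add: extended_form_def)
next
  case False
  \<comment> \<open>Otherwise the truncations would be an approximating sequence; so
    \<open>E\<close> agrees with the default value of the extended form.\<close>
  then have "E f = \<infinity>"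
    using approximating_truncation[OF f] by (metis infinity_ennreal_def top.not_eq_extremum)
  with False show ?thesis by (simp add: extended_form_def)
qed

lemma ext_domain_E: "ext_domain M E = {f \<in> borel_measurable M. E f < \<infinity>}"
  by (auto simp: ext_domain_def extended_form_E)

lemma ext_kernel_E: "ext_kernel M E = ae_constants M"
  unfolding ext_kernel_def ae_constants_def
  by (intro Collect_cong conj_cong refl) (simp add: extended_form_E E_eq_0_iff)

lemma ext_domain_iff:
  "f \<in> ext_domain M E \<longleftrightarrow> f \<in> borel_measurable M \<and> integrable N (\<lambda>z. (D f z)\<^sup>2)"
  by (auto simp: ext_domain_E integrable_iff_bounded E_def)

lemma ext_domain_add: "f \<in> ext_domain M E \<Longrightarrow> g \<in> ext_domain M E \<Longrightarrow> (\<lambda>x. f x + g x) \<in> ext_domain M E"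
  using E_add_le[of f g]
  by (auto simp: ext_domain_E ennreal_mult_less_top intro: le_less_trans)

lemma ext_domain_scale: "f \<in> ext_domain M E \<Longrightarrow> (\<lambda>x. c * f x) \<in> ext_domain M E"
  by (auto simp: ext_domain_E E_scale ennreal_mult_less_top)

text \<open>Polarization: the bilinear form is the \<open>L2\<close>-inner product over
  \<open>N\<close> of the increments.\<close>

lemma ext_bilinear_eq:
  assumes "f \<in> ext_domain M E" "g \<in> ext_domain M E"
  shows "integrable N (\<lambda>z. D f z * D g z)" "ext_bilinear M E f g = (LINT z|N. D f z * D g z)"
proof -
  have [measurable]: "f \<in> borel_measurable M" "g \<in> borel_measurable M"
    using assms by (auto simp: ext_domain_E)
  have "(\<lambda>x. f x - g x) \<in> ext_domain M E"
    using ext_domain_add[OF assms(1) ext_domain_scale[OF assms(2), of "-1"]] by simp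
  with ext_domain_add[OF assms]
  have i: "integrable N (\<lambda>z. (D f z + D g z)\<^sup>2)" "integrable N (\<lambda>z. (D f z - D g z)\<^sup>2)"
    by (simp_all add: ext_domain_iff D_add D_diff)
  have eq: "D f z * D g z = ((D f z + D g z)\<^sup>2 - (D f z - D g z)\<^sup>2) / 4" for z
    by (simp add: power2_eq_square algebra_simps)
  show "integrable N (\<lambda>z. D f z * D g z)"
    unfolding eq using i by simp
  show "ext_bilinear M E f g = (LINT z|N. D f z * D g z)"
    unfolding eq ext_bilinear_def using i
    by (simp add: extended_form_E E_def D_add D_diff nn_integral_eq_integral)
qed

end

section \<open>The quotient by the constants\<close>

lemma mod_const_iff:
  "(f, g) \<in> mod_const M \<longleftrightarrow>
    f \<in> borel_measurable M \<and> g \<in> borel_measurable M \<and> (\<exists>c. AE x in M. f x - g x = c)"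
  by (auto simp: mod_const_def)

lemma equiv_mod_const: "equiv (borel_measurable M) (mod_const M)"
proof (rule equivI)
  show "mod_const M \<subseteq> borel_measurable M \<times> borel_measurable M"
    by (auto simp: mod_const_def)
  show "refl_on (borel_measurable M) (mod_const M)"
    by (auto simp: refl_on_def mod_const_def)
  show "sym (mod_const M)"
  proof (rule symI)
    fix f g assume fg: "(f, g) \<in> mod_const M"
    then obtain c where "AE x in M. f x - g x = c" by (auto simp: mod_const_def)
    then have "AE x in M. g x - f x = - c" by eventually_elim simp
    with fg show "(g, f) \<in> mod_const M" by (auto simp: mod_const_def)
  qed
  show "trans (mod_const M)"
  proof (rule transI)
    fix f g h assume fg: "(f, g) \<in> mod_const M" and gh: "(g, h) \<in> mod_const M"
    then obtain c d where "AE x in M. f x - g x = c" "AE x in M. g x - h x = d"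
      by (auto simp: mod_const_def)
    then have "AE x in M. f x - h x = c + d" by eventually_elim simp
    with fg gh show "(f, h) \<in> mod_const M" by (auto simp: mod_const_def)
  qed
qed

lemma mod_const_class_eqI:
  assumes "f \<in> borel_measurable M" "g \<in> borel_measurable M" "AE x in M. f x - g x = c"
  shows "mod_const M `` {f} = mod_const M `` {g}"
  using assms by (intro equiv_class_eq[OF equiv_mod_const]) (auto simp: mod_const_def)

text \<open>All representatives yield the same class and at least one exists, so the union in
  \<open>quot_add\<close> collapses to that class.\<close>

lemma quot_add_class:
  assumes [measurable]: "f \<in> borel_measurable M" "g \<in> borel_measurable M"
  shows "quot_add M (mod_const M `` {f}) (mod_const M `` {g}) = mod_const M `` {\<lambda>x. f x + g x}"
proof -
  have "mod_const M `` {\<lambda>x. f' x + g' x} = mod_const M `` {\<lambda>x. f x + g x}"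
    if "f' \<in> mod_const M `` {f}" "g' \<in> mod_const M `` {g}" for f' g'
  proof -
    from that have [measurable]: "f' \<in> borel_measurable M" "g' \<in> borel_measurable M"
      by (auto simp: mod_const_iff)
    from that obtain c d where "AE x in M. f x - f' x = c" "AE x in M. g x - g' x = d"
      by (auto simp: mod_const_iff)
    then have "AE x in M. (f' x + g' x) - (f x + g x) = - (c + d)" by eventually_elim simp
    then show ?thesis by (rule mod_const_class_eqI[rotated 2]) measurable
  qed
  moreover have "f \<in> mod_const M `` {f}" "g \<in> mod_const M `` {g}"
    by (auto simp: mod_const_iff)
  ultimately show ?thesis
    unfolding quot_add_def by blast
qed

lemma quot_scale_class:
  assumes [measurable]: "f \<in> borel_measurable M"
  shows "quot_scale M a (mod_const M `` {f}) = mod_const M `` {\<lambda>x. a * f x}"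
proof -
  have "mod_const M `` {\<lambda>x. a * f' x} = mod_const M `` {\<lambda>x. a * f x}"
    if "f' \<in> mod_const M `` {f}" for f'
  proof -
    from that have [measurable]: "f' \<in> borel_measurable M"
      by (auto simp: mod_const_iff)
    from that obtain c where "AE x in M. f x - f' x = c"
      by (auto simp: mod_const_iff)
    then have "AE x in M. a * f' x - a * f x = - (a * c)"
      by eventually_elim (auto simp: algebra_simps)
    then show ?thesis by (rule mod_const_class_eqI[rotated 2]) measurable
  qed
  moreover have "f \<in> mod_const M `` {f}"
    by (auto simp: mod_const_iff)
  ultimately show ?thesis
    unfolding quot_scale_def by blast
qed

context jump_form
begin

section \<open>Increments as an isometric embedding of the quotient into the \<open>L2\<close>-space
  over \<open>N\<close>\<close>

lemma quot_spaceE: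
  assumes "p \<in> quot_space M E"
  obtains f where "f \<in> ext_domain M E" "f \<in> borel_measurable M" "p = mod_const M `` {f}"
  using assms by (auto simp: quot_space_def quotient_def ext_domain_iff)

lemma quot_spaceI: "f \<in> ext_domain M E \<Longrightarrow> mod_const M `` {f} \<in> quot_space M E"
  by (auto simp: quot_space_def quotient_def)

lemma mod_const_class_D:
  assumes "f \<in> ext_domain M E" "f' \<in> mod_const M `` {f}"
  shows "f' \<in> ext_domain M E" "AE z in N. D f' z = D f z"
proof -
  from assms(2) obtain c where [measurable]: "f' \<in> borel_measurable M"
    and c: "AE x in M. f x - f' x = c"
    by (auto simp: mod_const_iff)
  show "f' \<in> ext_domain M E"
    using assms(1) E_add_const[OF c] by (simp add: ext_domain_E)
  show "AE z in N. D f' z = D f z"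
    using AE_S[OF c] AE_P[OF c] by eventually_elim (simp add: D_def)
qed

lemma quot_inner_class:
  assumes f: "f \<in> ext_domain M E" and g: "g \<in> ext_domain M E"
  shows "quot_inner M E (mod_const M `` {f}) (mod_const M `` {g}) = (LINT z|N. D f z * D g z)"
proof -
  have [measurable]: "f \<in> borel_measurable M" "g \<in> borel_measurable M"
    using f g by (auto simp: ext_domain_iff)
  have "ext_bilinear M E f' g' = (LINT z|N. D f z * D g z)"
    if f': "f' \<in> mod_const M `` {f}" and g': "g' \<in> mod_const M `` {g}" for f' g'
  proof -
    note F = mod_const_class_D[OF f f'] and G = mod_const_class_D[OF g g']
    then have [measurable]: "f' \<in> borel_measurable M" "g' \<in> borel_measurable M"
      by (auto simp: ext_domain_iff)
    have "AE z in N. D f' z * D g' z = D f z * D g z"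
      using F(2) G(2) by eventually_elim simp
    then show ?thesis
      unfolding ext_bilinear_eq[OF F(1) G(1)] by (intro integral_cong_AE) auto
  qed
  then have "(\<Union>f'\<in>mod_const M `` {f}. \<Union>g'\<in>mod_const M `` {g}. {ext_bilinear M E f' g'})
      = (\<Union>f'\<in>mod_const M `` {f}. \<Union>g'\<in>mod_const M `` {g}. {LINT z|N. D f z * D g z})"
    by (intro SUP_cong refl) simp
  \<comment> \<open>Nonempty classes make the union a singleton, so that \<open>the_elem\<close>
    returns its value.\<close>
  moreover have "f \<in> mod_const M `` {f}" "g \<in> mod_const M `` {g}"
    by (auto simp: mod_const_iff)
  then have "(\<Union>f'\<in>mod_const M `` {f}. \<Union>g'\<in>mod_const M `` {g}. {LINT z|N. D f z * D g z})
      = {LINT z|N. D f z * D g z}"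
    by (auto simp del: Image_singleton_iff)
  ultimately show ?thesis by (simp add: quot_inner_def)
qed

lemma inner_product_space_E:
  "inner_product_space (quot_space M E) (quot_add M) (quot_zero M) (quot_scale M) (quot_inner M E)"
proof -
  have zero: "(\<lambda>x. 0) \<in> ext_domain M E"
    by (simp add: ext_domain_E E_def D_const)
  note simps = quot_add_class quot_scale_class quot_inner_class quot_zero_def quot_spaceI
    ext_domain_add ext_domain_scale zero
  show ?thesis
  proof (unfold_locales, goal_cases)
    case 1 then show ?case by (simp add: simps)
  next
    case (2 x y) then show ?case by (elim quot_spaceE) (simp add: simps)
  next
    case (3 x a) then show ?case by (elim quot_spaceE) (simp add: simps)
  next
    case (4 x y z) then show ?case by (elim quot_spaceE) (simp add: simps add.assoc)
  next
    case (5 x y) then show ?case by (elim quot_spaceE) (simp add: simps add.commute)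
  next
    case (6 x) then show ?case by (elim quot_spaceE) (simp add: simps)
  next
    case (7 x) then show ?case by (elim quot_spaceE) (simp add: simps)
  next
    case (8 x) then show ?case by (elim quot_spaceE) (simp add: simps)
  next
    case (9 x a b) then show ?case by (elim quot_spaceE) (simp add: simps mult.assoc)
  next
    case (10 x a b) then show ?case by (elim quot_spaceE) (simp add: simps distrib_right)
  next
    case (11 x y a) then show ?case by (elim quot_spaceE) (simp add: simps distrib_left)
  next
    case (12 x y) then show ?case by (elim quot_spaceE) (simp add: simps mult.commute)
  next
    case (13 x y z) then show ?case
      by (elim quot_spaceE) (simp add: simps D_add distrib_right ext_bilinear_eq(1))
  next
    case (14 x y a) then show ?case
      by (elim quot_spaceE) (simp add: simps D_scale mult.assoc)
  next
    case (15 x) then show ?case by (elim quot_spaceE) (simp add: simps)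
  next
    \<comment> \<open>Definiteness: norm zero means \<open>E f = 0\<close>, and then ergodicity
      makes \<open>f\<close> constant, so its class is zero.\<close>
    case (16 x)
    then obtain f where f: "f \<in> ext_domain M E" and [measurable]: "f \<in> borel_measurable M"
      and x: "x = mod_const M `` {f}" by (elim quot_spaceE)
    from 16(2) f have "E f = 0"
      by (simp add: x simps ext_domain_iff E_def nn_integral_eq_integral power2_eq_square)
    then obtain c where "AE x in M. f x - 0 = c" by (auto simp: E_eq_0_iff)
    then show ?case unfolding x quot_zero_def by (intro mod_const_class_eqI) auto
  qed
qed

text \<open>Since \<open>f \<mapsto> D f\<close> is isometric on the quotient, completeness makes
  its range closed; applied to a limit \<open>h\<close> of increments, it provides a primitive of
  \<open>h\<close>.\<close>

lemma hilbert_space_imp_closed_range: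
  assumes hilbert: "hilbert_space (quot_space M E) (quot_add M) (quot_zero M) (quot_scale M) (quot_inner M E)"
    and u: "\<And>n. u n \<in> ext_domain M E"
    and [measurable]: "h \<in> borel_measurable N"
    and lim: "(\<lambda>n. \<integral>\<^sup>+z. ennreal ((D (u n) z - h z)\<^sup>2) \<partial>N) \<longlonglongrightarrow> 0"
  obtains f where "f \<in> borel_measurable M" "AE z in N. D f z = h z"
proof -
  let ?V = "quot_space M E"
  let ?d = "\<lambda>x y. sqrt (quot_inner M E (quot_add M x (quot_scale M (-1) y)) (quot_add M x (quot_scale M (-1) y)))"
  define Q where "Q n = (\<integral>\<^sup>+z. ennreal ((D (u n) z - h z)\<^sup>2) \<partial>N)" for n
  have um [measurable]: "u n \<in> borel_measurable M" for n using u by (auto simp: ext_domain_iff)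
  have diff: "(\<lambda>x. f x - g x) \<in> ext_domain M E" if "f \<in> ext_domain M E" "g \<in> ext_domain M E" for f g
    using ext_domain_add[OF that(1) ext_domain_scale[OF that(2), of "-1"]] by simp
  have dist: "?d (mod_const M `` {f}) (mod_const M `` {g}) = sqrt (enn2real (E (\<lambda>x. f x - g x)))"
    if f: "f \<in> ext_domain M E" and g: "g \<in> ext_domain M E" for f g
  proof -
    have [measurable]: "f \<in> borel_measurable M" "g \<in> borel_measurable M"
      using f g by (auto simp: ext_domain_iff)
    show ?thesis
      using diff[OF f g]
      by (simp add: quot_add_class quot_scale_class quot_inner_class ext_domain_iff E_def
          nn_integral_eq_integral power2_eq_square)
  qed
  have EQ: "E (\<lambda>x. u m x - u n x) \<le> 2 * Q m + 2 * Q n" for m n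
    using nn_integral_power2_add_le[of "\<lambda>z. D (u m) z - h z" N "\<lambda>z. - (D (u n) z - h z)"]
    by (simp add: E_def D_diff Q_def power2_commute)
  have cauchy: "\<exists>N. \<forall>m\<ge>N. \<forall>n\<ge>N. ?d (mod_const M `` {u m}) (mod_const M `` {u n}) < e" if e: "e > 0" for e
  proof -
    \<comment> \<open>A quarter of \<open>e^2\<close> is right because \<open>E (u m - u n)\<close>
      is at most \<open>2 * Q m + 2 * Q n\<close>.\<close>
    have "\<forall>\<^sub>F n in sequentially. Q n < ennreal (e\<^sup>2 / 4)"
      using lim e unfolding Q_def by (intro order_tendstoD(2)[where y = 0]) auto
    then obtain K where K: "\<And>n. n \<ge> K \<Longrightarrow> Q n < ennreal (e\<^sup>2 / 4)"
      by (auto simp: eventually_sequentially)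
    have "?d (mod_const M `` {u m}) (mod_const M `` {u n}) < e" if mn: "m \<ge> K" "n \<ge> K" for m n
    proof -
      obtain a where a: "Q m = ennreal a" "a \<ge> 0" "a < e\<^sup>2 / 4"
        using K[OF mn(1)] by (cases "Q m") (auto simp: ennreal_less_iff)
      obtain b where b: "Q n = ennreal b" "b \<ge> 0" "b < e\<^sup>2 / 4"
        using K[OF mn(2)] by (cases "Q n") (auto simp: ennreal_less_iff)
      have "E (\<lambda>x. u m x - u n x) \<le> ennreal (2 * a + 2 * b)"
        using EQ[of m n] a b by (simp add: ennreal_plus ennreal_mult)
      then have "enn2real (E (\<lambda>x. u m x - u n x)) \<le> 2 * a + 2 * b"
        using a b by (simp add: enn2real_leI)
      also have "\<dots> < e\<^sup>2" using a b by simp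
      finally show ?thesis
        unfolding dist[OF u u] using e by (simp add: real_less_lsqrt)
    qed
    then show ?thesis by blast
  qed
  have "complete_wrt ?V ?d"
    using hilbert by (rule hilbert_space.complete)
  then have "\<exists>x\<in>?V. (\<lambda>n. ?d (mod_const M `` {u n}) x) \<longlonglongrightarrow> 0"
    unfolding complete_wrt_def
    by (rule allE[where x = "\<lambda>n. mod_const M `` {u n}"], elim mp)
      (intro conjI allI impI quot_spaceI u cauchy)
  then obtain x where x: "x \<in> ?V" and lx: "(\<lambda>n. ?d (mod_const M `` {u n}) x) \<longlonglongrightarrow> 0"
    by blast
  from x obtain f where f: "f \<in> ext_domain M E" and [measurable]: "f \<in> borel_measurable M"
    and xf: "x = mod_const M `` {f}" by (elim quot_spaceE)
  have "(\<lambda>n. (sqrt (enn2real (E (\<lambda>x. u n x - f x))))\<^sup>2) \<longlonglongrightarrow> 0\<^sup>2"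
    using lx unfolding xf dist[OF u f] by (rule tendsto_power)
  then have "(\<lambda>n. ennreal (enn2real (E (\<lambda>x. u n x - f x)))) \<longlonglongrightarrow> ennreal 0"
    by (intro tendsto_ennrealI) simp
  then have Ef: "(\<lambda>n. E (\<lambda>x. u n x - f x)) \<longlonglongrightarrow> 0"
    using diff[OF u f] by (simp add: ext_domain_E)
  have "(\<lambda>n. 2 * E (\<lambda>x. u n x - f x) + 2 * Q n) \<longlonglongrightarrow> 2 * 0 + 2 * 0"
    using lim unfolding Q_def by (intro tendsto_add ennreal_tendsto_cmult Ef) auto
  moreover have "(\<integral>\<^sup>+z. ennreal ((D f z - h z)\<^sup>2) \<partial>N) \<le> 2 * E (\<lambda>x. u n x - f x) + 2 * Q n" for n
    using nn_integral_power2_add_le[of "\<lambda>z. - (D (u n) z - D f z)" N "\<lambda>z. D (u n) z - h z"]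
    by (simp add: E_def D_diff Q_def power2_commute)
  \<comment> \<open>The left side does not depend on \<open>n\<close>, while the bound tends to
    0.\<close>
  ultimately have "(\<integral>\<^sup>+z. ennreal ((D f z - h z)\<^sup>2) \<partial>N) \<le> 0"
    by (intro LIMSEQ_le_const) auto
  then have "AE z in N. D f z = h z"
    by (simp add: nn_integral_0_iff_AE)
  then show thesis by (rule that[rotated]) simp
qed

end

section \<open>Flips of binary digits\<close>

text \<open>The parity is the binary digit of weight \<open>2^-(i+1)\<close>, counted from
  \<open>i = 0\<close>; digit 0 has sign 1. Adding this sign times the weight therefore exchanges
  the digits 0 and 1.\<close>

definition rademacher :: "nat \<Rightarrow> real \<Rightarrow> real" where
  "rademacher i x = (if even \<lfloor>2 ^ Suc i * x\<rfloor> then 1 else - 1)"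

definition flip :: "nat \<Rightarrow> real \<Rightarrow> real" where
  "flip i x = x + rademacher i x / 2 ^ Suc i"

text \<open>As a density on the whole line it keeps \<open>UNIV\<close> as its space, on which the
  flips are total.\<close>

definition unit_lborel :: "real measure" where
  "unit_lborel = density lborel (indicator {0..<1})"

lemma rademacher_measurable [measurable]: "rademacher i \<in> borel_measurable borel"
  unfolding rademacher_def[abs_def] by measurable

lemma flip_measurable [measurable]: "flip i \<in> borel_measurable borel"
  unfolding flip_def[abs_def] by measurable

lemma rademacher_cases: "rademacher i x = 1 \<or> rademacher i x = - 1"
  by (simp add: rademacher_def)

lemma abs_rademacher [simp]: "\<bar>rademacher i x\<bar> = 1"
  by (simp add: rademacher_def)

section \<open>Effect of a flip on the binary digits\<close>

lemma floor_power2_div: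
  fixes x :: real
  assumes "m \<le> n"
  shows "\<lfloor>2 ^ m * x\<rfloor> = \<lfloor>2 ^ n * x\<rfloor> div 2 ^ (n - m)"
proof -
  have "2 ^ m * x = (2 ^ n * x) / of_int (2 ^ (n - m))"
    using assms by (simp add: power_diff_conv_inverse field_simps flip: power_add)
  then show ?thesis using floor_divide_real_eq_div[of "2 ^ (n - m)" "2 ^ n * x"] by simp
qed

lemma floor_flip_self:
  "\<lfloor>2 ^ Suc i * flip i x\<rfloor> = \<lfloor>2 ^ Suc i * x\<rfloor> + (if even \<lfloor>2 ^ Suc i * x\<rfloor> then 1 else - 1)"
proof -
  have "2 ^ Suc i * flip i x = 2 ^ Suc i * x + of_int (if even \<lfloor>2 ^ Suc i * x\<rfloor> then 1 else - 1)"
    by (simp add: flip_def rademacher_def distrib_left)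
  then show ?thesis by (simp only: floor_add_int)
qed

lemma floor_flip_le:
  assumes "m \<le> i"
  shows "\<lfloor>2 ^ m * flip i x\<rfloor> = \<lfloor>2 ^ m * x\<rfloor>"
proof -
  define K where "K = \<lfloor>2 ^ Suc i * x\<rfloor>"
  have m: "m \<le> Suc i" "Suc i - m = Suc (i - m)" using assms by auto
  \<comment> \<open>Raising an even or lowering an odd integer by 1 leaves its half unchanged, so
    coarser digits do not notice the flip.\<close>
  have "(K + (if even K then 1 else - 1)) div 2 = K div 2" by presburger
  then have "(K + (if even K then 1 else - 1)) div 2 ^ (Suc i - m) = K div 2 ^ (Suc i - m)"
    unfolding m(2) power_Suc by (simp add: zdiv_zmult2_eq)
  then show ?thesis
    unfolding floor_power2_div[OF m(1)] floor_flip_self K_def .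
qed

text \<open>Coarser digits are fixed by \<open>floor_flip_le\<close>, the digit itself changes
  parity, and at a finer level \<open>j > i\<close> the shift is a multiple of the even number
  \<open>2^(j-i)\<close>.\<close>

lemma rademacher_flip:
  "rademacher j (flip i x) = (if j = i then - rademacher i x else rademacher j x)"
proof (cases j i rule: linorder_cases)
  case less
  then show ?thesis by (simp add: rademacher_def floor_flip_le del: power_Suc)
next
  case equal
  then show ?thesis by (auto simp: rademacher_def floor_flip_self simp del: power_Suc)
next
  case greater
  define s :: int where "s = (if even \<lfloor>2 ^ Suc i * x\<rfloor> then 1 else - 1)"
  have "2 ^ Suc j * flip i x = 2 ^ Suc j * x + 2 ^ (j - i) * of_int s"
    using greater by (simp add: flip_def rademacher_def s_def distrib_left power_diff)
  also have "\<dots> = 2 ^ Suc j * x + of_int (2 ^ (j - i) * s)"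
    by simp
  finally have "\<lfloor>2 ^ Suc j * flip i x\<rfloor> = \<lfloor>2 ^ Suc j * x\<rfloor> + 2 ^ (j - i) * s"
    by (simp only: floor_add_int)
  then have "even \<lfloor>2 ^ Suc j * flip i x\<rfloor> \<longleftrightarrow> even \<lfloor>2 ^ Suc j * x\<rfloor>"
    using greater by simp
  then show ?thesis using greater by (simp add: rademacher_def)
qed

lemma flip_flip: "flip i (flip i x) = x"
proof -
  have "flip i (flip i x) = flip i x + rademacher i (flip i x) / 2 ^ Suc i"
    by (simp only: flip_def[of i "flip i x"])
  also have "\<dots> = x"
    unfolding rademacher_flip by (simp add: flip_def)
  finally show ?thesis .
qed

lemma flip_unit: "flip i x \<in> {0..<1} \<longleftrightarrow> x \<in> {0..<1}"
proof -
  \<comment> \<open>Membership in the interval is the floor at level 0, which no flip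
    alters.\<close>
  have "y \<in> {0..<1} \<longleftrightarrow> \<lfloor>2 ^ 0 * y\<rfloor> = 0" for y :: real
    by (auto simp: floor_eq_iff)
  then show ?thesis using floor_flip_le[of 0 i x] by simp
qed

lemma sets_unit_lborel [simp, measurable_cong]: "sets unit_lborel = sets borel"
  and space_unit_lborel [simp]: "space unit_lborel = UNIV"
  by (simp_all add: unit_lborel_def)

lemma emeasure_unit_lborel:
  "A \<in> sets borel \<Longrightarrow> emeasure unit_lborel A = emeasure lborel ({0..<1} \<inter> A)"
  by (simp add: unit_lborel_def emeasure_restricted)

lemma prob_space_unit_lborel: "prob_space unit_lborel"
  by (rule prob_spaceI) (simp add: emeasure_unit_lborel)

text \<open>Where the sign is constant the flip is a translation; it carries this half of the
  interval onto the other one. Translation invariance of Lebesgue measure does the rest.\<close>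

lemma distr_flip: "distr unit_lborel unit_lborel (flip i) = unit_lborel"
proof (rule measure_eqI)
  fix B assume "B \<in> sets (distr unit_lborel unit_lborel (flip i))"
  then have B [measurable]: "B \<in> sets borel" by simp
  define C where "C s = {x \<in> {0..<1}. rademacher i x = s}" for s
  have C [measurable]: "C s \<in> sets borel" for s
    unfolding C_def by measurable
  have shift: "emeasure lborel {x \<in> C s. flip i x \<in> B} = emeasure lborel (C (- s) \<inter> B)" for s
  proof -
    let ?h = "s / 2 ^ Suc i"
    have "{x \<in> C s. flip i x \<in> B} = (+) ?h -` (C (- s) \<inter> B)"
    proof (intro equalityI subsetI)
      fix x assume "x \<in> {x \<in> C s. flip i x \<in> B}"
      then have x: "x \<in> {0..<1}" "rademacher i x = s" "flip i x \<in> B" by (auto simp: C_def)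
      then have "?h + x = flip i x" by (simp add: flip_def)
      then show "x \<in> (+) ?h -` (C (- s) \<inter> B)"
        using x flip_unit[of i x] rademacher_flip[of i i x] by (simp add: C_def)
    next
      fix x assume "x \<in> (+) ?h -` (C (- s) \<inter> B)"
      then have y: "?h + x \<in> {0..<1}" "rademacher i (?h + x) = - s" "?h + x \<in> B"
        by (auto simp: C_def)
      \<comment> \<open>At \<open>?h + x\<close> the sign is \<open>- s\<close>, so the flip
        subtracts \<open>?h\<close> again.\<close>
      then have x: "flip i (?h + x) = x" by (simp add: flip_def)
      then have "flip i x = ?h + x" by (metis flip_flip)
      then show "x \<in> {x \<in> C s. flip i x \<in> B}"
        using y x flip_unit[of i "?h + x"] rademacher_flip[of i i "?h + x"] by (simp add: C_def)
    qed
    then have "emeasure lborel {x \<in> C s. flip i x \<in> B} = emeasure (distr lborel borel ((+) ?h)) (C (- s) \<inter> B)"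
      by (simp add: emeasure_distr)
    then show ?thesis by (simp only: lborel_distr_plus)
  qed
  have split: "emeasure lborel {x \<in> {0..<1}. Q x}
      = emeasure lborel {x \<in> C 1. Q x} + emeasure lborel {x \<in> C (- 1). Q x}"
    if [measurable]: "Measurable.pred borel Q" for Q
  proof -
    have "{x \<in> {0..<1}. Q x} = {x \<in> C 1. Q x} \<union> {x \<in> C (- 1). Q x}"
      using rademacher_cases[of i] by (auto simp: C_def)
    moreover have "{x \<in> C 1. Q x} \<inter> {x \<in> C (- 1). Q x} = {}"
      by (auto simp: C_def)
    moreover have "{x \<in> C s. Q x} \<in> sets lborel" for s
      by measurable
    ultimately show ?thesis by (simp only: plus_emeasure)
  qed
  have "emeasure (distr unit_lborel unit_lborel (flip i)) B = emeasure unit_lborel (flip i -` B)"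
    by (subst emeasure_distr) auto
  also have "\<dots> = emeasure lborel {x \<in> {0..<1}. flip i x \<in> B}"
  proof -
    have "flip i -` B \<in> sets borel" using measurable_sets[OF flip_measurable B] by simp
    then show ?thesis by (auto simp: emeasure_unit_lborel intro!: arg_cong[where f = "emeasure lborel"])
  qed
  also have "\<dots> = emeasure lborel {x \<in> C 1. flip i x \<in> B} + emeasure lborel {x \<in> C (- 1). flip i x \<in> B}"
    by (rule split) measurable
  also have "\<dots> = emeasure lborel {x \<in> C 1. x \<in> B} + emeasure lborel {x \<in> C (- 1). x \<in> B}"
    by (simp only: shift minus_minus Int_def add.commute)
  also have "\<dots> = emeasure lborel {x \<in> {0..<1}. x \<in> B}"
    by (rule split[symmetric]) measurable
  also have "\<dots> = emeasure unit_lborel B"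
    by (auto simp: emeasure_unit_lborel intro!: arg_cong[where f = "emeasure lborel"])
  finally show "emeasure (distr unit_lborel unit_lborel (flip i)) B = emeasure unit_lborel B" .
qed simp

lemma measure_flip_vimage:
  assumes [measurable]: "B \<in> sets borel"
  shows "measure unit_lborel (flip i -` B) = measure unit_lborel B"
proof -
  have "measure unit_lborel B = measure (distr unit_lborel unit_lborel (flip i)) B"
    by (simp only: distr_flip)
  also have "\<dots> = measure unit_lborel (flip i -` B)"
    by (subst measure_distr) auto
  finally show ?thesis ..
qed

section \<open>Ergodicity of the flips\<close>

context
  fixes A :: "real set"
  assumes A [measurable]: "A \<in> sets borel"
    and A_flip: "\<And>i. AE x in unit_lborel. flip i x \<in> A \<longleftrightarrow> x \<in> A"
begin

interpretation prob_space unit_lborel by (rule prob_space_unit_lborel)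

abbreviation cell :: "nat \<Rightarrow> int \<Rightarrow> real set" where
  "cell n k \<equiv> {x. \<lfloor>2 ^ n * x\<rfloor> = k}"

text \<open>Flipping the last digit exchanges the two halves of a dyadic cell.\<close>

lemma measure_invariant_cell:
  assumes "0 \<le> k" "k < 2 ^ n"
  shows "prob (A \<inter> cell n k) = prob A / 2 ^ n"
  using assms
proof (induction n arbitrary: k)
  case 0
  have "emeasure unit_lborel (A \<inter> cell 0 k) = emeasure unit_lborel A"
    using 0 by (auto simp: emeasure_unit_lborel floor_eq_iff intro!: arg_cong[where f = "emeasure lborel"])
  then show ?case by (simp add: measure_def)
next
  case (Suc n)
  \<comment> \<open>The parent cell, whose halves \<open>2 * l\<close> and \<open>2 * l + 1\<close>
    carry equal shares of \<open>A\<close>.\<close>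
  define l where "l = k div 2"
  have l: "0 \<le> l" "l < 2 ^ n" "k = 2 * l \<or> k = 2 * l + 1" using Suc.prems by (auto simp: l_def)
  have eq: "prob (A \<inter> cell (Suc n) (2 * l + 1)) = prob (A \<inter> cell (Suc n) (2 * l))"
  proof -
    have "prob (A \<inter> cell (Suc n) (2 * l + 1)) = prob (flip n -` (A \<inter> cell (Suc n) (2 * l + 1)))"
      by (rule measure_flip_vimage[symmetric]) measurable
    also have "\<dots> = prob (A \<inter> cell (Suc n) (2 * l))"
    proof (rule finite_measure_eq_AE)
      show "AE x in unit_lborel. x \<in> flip n -` (A \<inter> cell (Suc n) (2 * l + 1)) \<longleftrightarrow> x \<in> A \<inter> cell (Suc n) (2 * l)"
        using A_flip[of n]
      proof eventually_elim
        case (elim x)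
        have "\<lfloor>2 ^ Suc n * flip n x\<rfloor> = 2 * l + 1 \<longleftrightarrow> \<lfloor>2 ^ Suc n * x\<rfloor> = 2 * l"
          unfolding floor_flip_self by presburger
        with elim show ?case by (simp del: power_Suc)
      qed
      show "flip n -` (A \<inter> cell (Suc n) (2 * l + 1)) \<in> events"
        using measurable_sets[OF flip_measurable, of "A \<inter> cell (Suc n) (2 * l + 1)"] by simp
    qed measurable
    finally show ?thesis .
  qed
  have "A \<inter> cell n l = (A \<inter> cell (Suc n) (2 * l)) \<union> (A \<inter> cell (Suc n) (2 * l + 1))"
  proof -
    have "\<lfloor>2 ^ n * x\<rfloor> = l \<longleftrightarrow> \<lfloor>2 ^ Suc n * x\<rfloor> = 2 * l \<or> \<lfloor>2 ^ Suc n * x\<rfloor> = 2 * l + 1" for x :: real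
      using floor_power2_div[of n "Suc n" x] by (auto simp del: power_Suc)
    then show ?thesis by blast
  qed
  then have "prob (A \<inter> cell n l) = prob (A \<inter> cell (Suc n) (2 * l)) + prob (A \<inter> cell (Suc n) (2 * l + 1))"
    by (simp only:, subst finite_measure_Union) auto
  with Suc.IH[OF l(1,2)] eq l(3) show ?case by auto
qed

lemma measure_invariant_dyadic:
  assumes "m \<le> 2 ^ n"
  shows "prob (A \<inter> {x. \<lfloor>2 ^ n * x\<rfloor> < int m}) = m / 2 ^ n * prob A"
  using assms
proof (induction m)
  case 0
  have "emeasure unit_lborel (A \<inter> {x. \<lfloor>2 ^ n * x\<rfloor> < int 0}) = 0"
  proof -
    \<comment> \<open>A negative floor means a negative point, outside the unit interval.\<close>
    have "{0..<1} \<inter> (A \<inter> {x. \<lfloor>2 ^ n * x\<rfloor> < int 0}) = {}" by (auto simp: zero_le_mult_iff floor_less_iff not_less mult_less_0_iff)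
    then show ?thesis by (simp add: emeasure_unit_lborel)
  qed
  then show ?case by (simp add: measure_def)
next
  case (Suc m)
  have "A \<inter> {x. \<lfloor>2 ^ n * x\<rfloor> < int (Suc m)} = A \<inter> {x. \<lfloor>2 ^ n * x\<rfloor> < int m} \<union> A \<inter> cell n (int m)"
    by auto
  then have "prob (A \<inter> {x. \<lfloor>2 ^ n * x\<rfloor> < int (Suc m)})
      = prob (A \<inter> {x. \<lfloor>2 ^ n * x\<rfloor> < int m}) + prob (A \<inter> cell n (int m))"
    by (simp only:, subst finite_measure_Union) auto
  moreover have "int m < 2 ^ n" using Suc.prems by (metis Suc_le_lessD of_nat_less_numeral_power_cancel_iff)
  ultimately show ?case
    using Suc by (simp add: measure_invariant_cell add_divide_distrib distrib_right)
qed

lemma measure_invariant_Iic: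
  assumes t: "0 \<le> t" "t < 1"
  shows "prob (A \<inter> {..t}) = t * prob A"
proof -
  have "\<bar>prob (A \<inter> {..t}) - t * prob A\<bar> \<le> (1 / 2) ^ n" for n
  proof -
    \<comment> \<open>\<open>{..t}\<close> lies between the points below \<open>m / 2^n\<close> and
      those below \<open>(m + 1) / 2^n\<close>; these bounds differ by at most \<open>2^-n\<close>
      in measure.\<close>
    define m where "m = nat \<lfloor>2 ^ n * t\<rfloor>"
    have m: "int m = \<lfloor>2 ^ n * t\<rfloor>" using t by (simp add: m_def)
    have mle: "real m \<le> 2 ^ n * t" "2 ^ n * t < real m + 1"
      using m by linarith+
    have "2 ^ n * t < 2 ^ n" using t by simp
    then have "real m < 2 ^ n" using mle by linarith
    then have mn: "m < 2 ^ n" by simp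
    have "prob (A \<inter> {x. \<lfloor>2 ^ n * x\<rfloor> < int m}) \<le> prob (A \<inter> {..t})"
    proof (rule finite_measure_mono)
      show "A \<inter> {x. \<lfloor>2 ^ n * x\<rfloor> < int m} \<subseteq> A \<inter> {..t}"
      proof (intro Int_mono subset_refl subsetI, simp)
        fix x :: real assume "\<lfloor>2 ^ n * x\<rfloor> < int m"
        then have "2 ^ n * x < 2 ^ n * t" using m mle by linarith
        then show "x \<le> t" by simp
      qed
    qed measurable
    then have 1: "m / 2 ^ n * prob A \<le> prob (A \<inter> {..t})"
      using measure_invariant_dyadic[of m n] mn by simp
    have "prob (A \<inter> {..t}) \<le> prob (A \<inter> {x. \<lfloor>2 ^ n * x\<rfloor> < int (Suc m)})"
    proof (rule finite_measure_mono)
      show "A \<inter> {..t} \<subseteq> A \<inter> {x. \<lfloor>2 ^ n * x\<rfloor> < int (Suc m)}"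
      proof (intro Int_mono subset_refl subsetI, simp)
        fix x :: real assume "x \<le> t"
        then have "2 ^ n * x \<le> 2 ^ n * t" by simp
        then show "\<lfloor>2 ^ n * x\<rfloor> < 1 + int m" using m mle by linarith
      qed
    qed measurable
    then have 2: "prob (A \<inter> {..t}) \<le> (m + 1) / 2 ^ n * prob A"
      using measure_invariant_dyadic[of "Suc m" n] mn by (simp add: add.commute)
    have tm: "m / 2 ^ n \<le> t" "t \<le> (m + 1) / 2 ^ n"
      using mle by (simp_all add: field_simps)
    have 3: "m / 2 ^ n * prob A \<le> t * prob A" "t * prob A \<le> (m + 1) / 2 ^ n * prob A"
      by (intro mult_right_mono tm measure_nonneg)+
    have "(m + 1) / 2 ^ n * prob A - m / 2 ^ n * prob A = prob A * (1 / 2) ^ n"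
      by (simp add: field_simps)
    also have "\<dots> \<le> 1 * (1 / 2) ^ n" by (intro mult_right_mono) auto
    finally show ?thesis using 1 2 3 by linarith
  qed
  then have "\<bar>prob (A \<inter> {..t}) - t * prob A\<bar> \<le> 0"
    by (intro LIMSEQ_le_const[OF LIMSEQ_realpow_zero[of "1/2"]]) auto
  then show ?thesis by simp
qed

text \<open>An invariant set is independent of every half-line, hence of itself.\<close>

lemma prob_invariant: "prob A = 0 \<or> prob A = 1"
proof -
  have unit_Ioi: "emeasure unit_lborel (A \<inter> {t<..}) = ennreal (prob A) * emeasure unit_lborel {t<..}" for t
  proof -
    consider "t < 0" | "0 \<le> t" "t < 1" | "1 \<le> t" by linarith
    then show ?thesis
    proof cases
      case 1
      then have "{0..<1} \<inter> (A \<inter> {t<..}) = {0..<1} \<inter> A" "{0..<1} \<inter> {t<..} = {0..<1}" by auto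
      then have "emeasure unit_lborel (A \<inter> {t<..}) = emeasure unit_lborel A"
        "emeasure unit_lborel {t<..} = 1"
        by (simp_all add: emeasure_unit_lborel)
      then show ?thesis by (simp add: emeasure_eq_measure)
    next
      case 2
      have "A \<inter> {t<..} = A - (A \<inter> {..t})" by auto
      then have "prob (A \<inter> {t<..}) = prob A - prob (A \<inter> {..t})"
        by (simp only:, subst finite_measure_Diff) auto
      also have "\<dots> = prob A * (1 - t)"
        using measure_invariant_Iic[OF 2] by (simp add: algebra_simps)
      finally have "emeasure unit_lborel (A \<inter> {t<..}) = ennreal (prob A) * ennreal (1 - t)"
        using 2 by (simp add: emeasure_eq_measure ennreal_mult)
      moreover have "{0..<1} \<inter> {t<..} = {t<..<1}" using 2 by auto
      then have "emeasure unit_lborel {t<..} = ennreal (1 - t)"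
        using 2 by (simp add: emeasure_unit_lborel)
      ultimately show ?thesis by simp
    next
      case 3
      then have "{0..<1} \<inter> (A \<inter> {t<..}) = {}" "{0..<1} \<inter> {t<..} = {}" by auto
      then show ?thesis by (simp add: emeasure_unit_lborel)
    qed
  qed
  \<comment> \<open>Half-lines determine a finite measure, so independence from them extends to all
    Borel sets, in particular to \<open>A\<close> itself, where it reads
    \<open>prob A = prob A * prob A\<close>.\<close>
  have "density unit_lborel (indicator A) = density unit_lborel (\<lambda>x. ennreal (prob A))"
  proof (rule measure_eqI_lessThan)
    fix t
    show "emeasure (density unit_lborel (indicator A)) {t<..}
        = emeasure (density unit_lborel (\<lambda>x. ennreal (prob A))) {t<..}"
      using unit_Ioi[of t] by (simp add: emeasure_restricted emeasure_density_const)
    show "emeasure (density unit_lborel (indicator A)) {t<..} < \<infinity>"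
      by (simp add: emeasure_restricted emeasure_eq_measure)
  qed auto
  then have "emeasure (density unit_lborel (indicator A)) A
      = emeasure (density unit_lborel (\<lambda>x. ennreal (prob A))) A"
    by simp
  then have "ennreal (prob A) = ennreal (prob A * prob A)"
    by (simp add: emeasure_restricted emeasure_density_const emeasure_eq_measure ennreal_mult)
  then have "prob A = prob A * prob A" by simp
  then show ?thesis by simp
qed

end

text \<open>Each rational sublevel set is invariant, hence null or conull. Almost all values of
  \<open>f\<close> then define the same cut in the rationals and coincide.\<close>

lemma flip_ergodic:
  fixes f :: "real \<Rightarrow> real"
  assumes [measurable]: "f \<in> borel_measurable borel"
    and f_flip: "\<And>i. AE x in unit_lborel. f (flip i x) = f x"
  shows "\<exists>c. AE x in unit_lborel. f x = c"
proof -
  interpret prob_space unit_lborel by (rule prob_space_unit_lborel)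
  have "\<exists>b. AE x in unit_lborel. f x \<le> of_rat q \<longleftrightarrow> b" for q
  proof -
    let ?A = "{x. f x \<le> of_rat q}"
    have "prob ?A = 0 \<or> prob ?A = 1"
    proof (rule prob_invariant)
      show "AE x in unit_lborel. flip i x \<in> ?A \<longleftrightarrow> x \<in> ?A" for i
        using f_flip[of i] by eventually_elim simp
    qed measurable
    then show ?thesis
    proof
      assume "prob ?A = 0"
      then have "AE x in unit_lborel. \<not> x \<in> ?A" by (simp add: prob_eq_0)
      then show ?thesis by (intro exI[of _ False]) simp
    next
      assume "prob ?A = 1"
      then have "AE x in unit_lborel. x \<in> ?A" by (subst (asm) prob_eq_1) auto
      then show ?thesis by (intro exI[of _ True]) simp
    qed
  qed
  then obtain b where "\<And>q. AE x in unit_lborel. f x \<le> of_rat q \<longleftrightarrow> b q" by metis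
  then have b: "AE x in unit_lborel. \<forall>q. f x \<le> of_rat q \<longleftrightarrow> b q"
    by (subst AE_all_countable) simp
  \<comment> \<open>Any point of the conull set supplies the constant.\<close>
  from eventually_happens[OF this] ae_filter_bot obtain x0 where x0: "\<And>q. f x0 \<le> of_rat q \<longleftrightarrow> b q"
    by auto
  have "AE x in unit_lborel. f x = f x0"
    using b
  proof eventually_elim
    case (elim x)
    then have le: "f x \<le> of_rat q \<longleftrightarrow> f x0 \<le> of_rat q" for q by (simp add: x0)
    show ?case
    proof (rule ccontr)
      assume "f x \<noteq> f x0"
      then consider "f x < f x0" | "f x0 < f x" by linarith
      then show False
      proof cases
        case 1
        from of_rat_dense[OF 1] le show False by (metis less_imp_le not_le)
      next
        case 2
        from of_rat_dense[OF 2] le show False by (metis less_imp_le not_le)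
      qed
    qed
  qed
  then show ?thesis by blast
qed

section \<open>Exponentially growing flip increments have no measurable primitive\<close>

lemma ex_prob_abs_le_gt_half:
  fixes f :: "real \<Rightarrow> real"
  assumes [measurable]: "f \<in> borel_measurable borel"
  shows "\<exists>K::nat. measure unit_lborel {x. \<bar>f x\<bar> \<le> real K} > 1 / 2"
proof -
  interpret prob_space unit_lborel by (rule prob_space_unit_lborel)
  have "(\<lambda>K::nat. prob {x. \<bar>f x\<bar> \<le> real K}) \<longlonglongrightarrow> prob (\<Union>K::nat. {x. \<bar>f x\<bar> \<le> real K})"
  proof (rule finite_Lim_measure_incseq)
    show "incseq (\<lambda>K::nat. {x. \<bar>f x\<bar> \<le> real K})"
      by (rule incseq_SucI) auto
  qed (intro image_subsetI, measurable)
  moreover have "(\<Union>K::nat. {x. \<bar>f x\<bar> \<le> real K}) = UNIV"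
    using real_arch_simple by auto
  moreover have "prob UNIV = 1" using prob_space by simp
  ultimately have "\<forall>\<^sub>F K::nat in sequentially. 1 / 2 < prob {x. \<bar>f x\<bar> \<le> real K}"
    by (intro order_tendstoD(1)) auto
  from eventually_happens[OF this] show ?thesis by simp
qed

lemma no_flip_primitive:
  fixes f :: "real \<Rightarrow> real"
  assumes [measurable]: "f \<in> borel_measurable borel"
    and f: "\<And>i. AE x in unit_lborel. \<bar>f (flip i x) - f x\<bar> = 2 * 2 ^ i"
  shows False
proof -
  interpret prob_space unit_lborel by (rule prob_space_unit_lborel)
  obtain K :: nat where K: "prob {x. \<bar>f x\<bar> \<le> real K} > 1 / 2"
    using ex_prob_abs_le_gt_half[of f] by auto
  define A where "A = {x. \<bar>f x\<bar> \<le> real K}"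
  have A [measurable]: "A \<in> sets borel" unfolding A_def by measurable
  have B: "flip K -` A \<in> sets borel" using measurable_sets[OF flip_measurable A] by simp
  \<comment> \<open>\<open>K\<close> also serves as the flipped index: the increment
    \<open>2 * 2^K\<close> exceeds \<open>2 K\<close>, so \<open>|f|\<close> cannot be at most
    \<open>K\<close> at both ends.\<close>
  have "real K < 2 ^ K" by (rule of_nat_less_two_power)
  from f[of K] have "AE x in unit_lborel. x \<notin> A \<or> x \<notin> flip K -` A"
  proof eventually_elim
    case (elim x)
    with \<open>real K < 2 ^ K\<close> have "\<bar>f x\<bar> > real K \<or> \<bar>f (flip K x)\<bar> > real K" by linarith
    then show ?case by (auto simp: A_def)
  qed
  then have "prob (A \<union> flip K -` A) = prob A + prob (flip K -` A)"
    using B by (intro measure_Un_AE) (auto simp: fmeasurable_eq_sets)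
  then have "prob (A \<union> flip K -` A) > 1"
    using K by (simp add: measure_flip_vimage A_def[symmetric])
  then show False using prob_le_1[of "A \<union> flip K -` A"] by linarith
qed

section \<open>The flip form\<close>

text \<open>The parameter gives index \<open>i\<close> the mass \<open>(7/8) (1/8)^i\<close>:
  positive for every index, yet summable against \<open>4^i\<close>.\<close>

abbreviation flip_index :: "nat measure" where
  "flip_index \<equiv> measure_pmf (geometric_pmf (7 / 8))"

abbreviation flip_choice :: "(nat \<times> real) measure" where
  "flip_choice \<equiv> flip_index \<Otimes>\<^sub>M unit_lborel"

abbreviation flip_at :: "nat \<times> real \<Rightarrow> real" where
  "flip_at z \<equiv> flip (fst z) (snd z)"

lemma index_measurable:
  assumes "\<And>i. g i \<in> borel_measurable borel"
  shows "(\<lambda>z. g (fst z) (snd z)) \<in> borel_measurable flip_choice"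
proof -
  have "(\<lambda>z. g (fst z) (snd z)) \<in> borel_measurable (count_space UNIV \<Otimes>\<^sub>M borel)"
    using assms by (intro measurable_pair_measure_countable1) auto
  also have "borel_measurable (count_space UNIV \<Otimes>\<^sub>M borel) = borel_measurable flip_choice"
    by (intro measurable_cong_sets sets_pair_measure_cong) auto
  finally show ?thesis .
qed

interpretation unit: prob_space unit_lborel
  by (rule prob_space_unit_lborel)

interpretation flip_choice: pair_prob_space flip_index unit_lborel ..

text \<open>Every index has positive mass, so an a.e. statement on the product holds a.e. for each
  single index.\<close>

lemma AE_flip_choiceD:
  assumes "AE z in flip_choice. Q (fst z) (snd z)"
  shows "AE x in unit_lborel. Q i x"
proof -
  have "AE i in flip_index. AE x in unit_lborel. Q i x"
    using flip_choice.AE_pair[OF assms] by simp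
  then show ?thesis
    by (simp add: AE_measure_pmf_iff set_pmf_geometric)
qed

text \<open>A random choice among measure-preserving maps preserves the measure.\<close>

lemma distr_flip_choice:
  assumes g: "\<And>i. g i \<in> borel_measurable borel" and "\<And>i. distr unit_lborel unit_lborel (g i) = unit_lborel"
  shows "distr flip_choice unit_lborel (\<lambda>z. g (fst z) (snd z)) = unit_lborel"
proof (rule measure_eqI)
  fix B assume "B \<in> sets (distr flip_choice unit_lborel (\<lambda>z. g (fst z) (snd z)))"
  then have B [measurable]: "B \<in> sets borel" by simp
  have m: "(\<lambda>z. g (fst z) (snd z)) \<in> measurable flip_choice unit_lborel"
    using index_measurable[of g, OF g] by (simp cong: measurable_cong_sets)
  have eq: "emeasure unit_lborel {x. g i x \<in> B} = emeasure unit_lborel B" for i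
  proof -
    have "emeasure unit_lborel B = emeasure (distr unit_lborel unit_lborel (g i)) B"
      by (simp only: assms)
    also have "\<dots> = emeasure unit_lborel {x. g i x \<in> B}"
      using g[of i] by (subst emeasure_distr) (auto simp: vimage_def cong: measurable_cong_sets)
    finally show ?thesis ..
  qed
  have "emeasure (distr flip_choice unit_lborel (\<lambda>z. g (fst z) (snd z))) B
      = emeasure flip_choice ((\<lambda>z. g (fst z) (snd z)) -` B \<inter> space flip_choice)"
    using m B by (subst emeasure_distr) auto
  also have "\<dots> = (\<integral>\<^sup>+i. emeasure unit_lborel {x. g i x \<in> B} \<partial>flip_index)"
    using measurable_sets[OF m, of B] B
    by (subst unit.emeasure_pair_measure_alt) (auto simp: vimage_def space_pair_measure)
  also have "\<dots> = emeasure unit_lborel B"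
    by (simp add: eq)
  finally show "emeasure (distr flip_choice unit_lborel (\<lambda>z. g (fst z) (snd z))) B = emeasure unit_lborel B" .
qed simp

text \<open>The jump starts at a uniform point and flips an independently chosen digit.\<close>

interpretation flips: jump_form unit_lborel flip_choice flip_at snd
proof
  show "flip_at \<in> measurable flip_choice unit_lborel"
    using index_measurable[of flip] by (simp cong: measurable_cong_sets)
  show "distr flip_choice unit_lborel flip_at = unit_lborel"
    by (rule distr_flip_choice) (simp_all add: distr_flip)
  have "distr unit_lborel unit_lborel (\<lambda>x. x) = unit_lborel" by (rule distr_id)
  then show "distr flip_choice unit_lborel snd = unit_lborel"
    using distr_flip_choice[of "\<lambda>i x. x"] by simp
  show "\<exists>c. AE x in unit_lborel. f x = c"
    if "f \<in> borel_measurable unit_lborel" "AE z in flip_choice. f (flip_at z) = f (snd z)"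
    for f :: "real \<Rightarrow> real"
    using that AE_flip_choiceD[of "\<lambda>i x. f (flip i x) = f x"]
    by (intro flip_ergodic) (auto cong: measurable_cong_sets)
qed measurable

section \<open>A Cauchy sequence without limit\<close>

text \<open>
  The \<open>i\<close>-th flip has weight \<open>(7/8) 8\<^sup>-\<^sup>i\<close>. Against it the increments \<open>\<plusminus>2 \<cdot> 2\<^sup>i\<close> of the following sums are
  square-integrable although they are unbounded.
\<close>

definition digit_sum :: "nat \<Rightarrow> real \<Rightarrow> real" where
  "digit_sum n x = (\<Sum>k<n. 2 ^ k * rademacher k x)"

lemma digit_sum_measurable [measurable]: "digit_sum n \<in> borel_measurable borel"
  unfolding digit_sum_def[abs_def] by measurable

text \<open>The flip reverses the sign of a single summand.\<close>

lemma D_digit_sum: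
  "flips.D (digit_sum n) z = (if fst z < n then - 2 * 2 ^ fst z * rademacher (fst z) (snd z) else 0)"
proof -
  have "flips.D (digit_sum n) z
      = (\<Sum>k<n. if k = fst z then - 2 * 2 ^ fst z * rademacher (fst z) (snd z) else 0)"
    unfolding flips.D_def digit_sum_def sum_subtractf[symmetric]
    by (intro sum.cong) (auto simp: rademacher_flip)
  then show ?thesis by simp
qed

lemma digit_sum_ext_domain: "digit_sum n \<in> ext_domain unit_lborel flips.E"
proof -
  have "\<bar>digit_sum n x\<bar> \<le> (\<Sum>k<n. 2 ^ k)" for x
    unfolding digit_sum_def by (rule order_trans[OF sum_abs]) (simp add: abs_mult)
  then have "digit_sum n \<in> form_domain unit_lborel flips.E"
    unfolding flips.form_domain_E by (intro unit.L2_bounded) (auto cong: measurable_cong_sets)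
  then show ?thesis
    by (auto simp: form_domain_def flips.ext_domain_E cong: measurable_cong_sets)
qed

text \<open>The weighted terms form the geometric series of \<open>(7/2) (1/2)^i\<close>.\<close>

lemma nn_integral_geometric_4_power: "(\<integral>\<^sup>+i. ennreal (4 * 4 ^ i) \<partial>flip_index) < \<infinity>"
proof -
  have eq: "(1 - 7 / 8) ^ i * (7 / 8) * (4 * 4 ^ i) = (7 / 2) * (1 / 2 :: real) ^ i" for i
    by (simp flip: power_mult_distrib)
  have "(\<integral>\<^sup>+i. ennreal (4 * 4 ^ i) \<partial>flip_index)
      = (\<integral>\<^sup>+i. ennreal ((7 / 2) * (1 / 2) ^ i) \<partial>count_space UNIV)"
    unfolding nn_integral_measure_pmf
  proof (rule nn_integral_cong)
    fix i
    have "ennreal (pmf (geometric_pmf (7 / 8)) i) * ennreal (4 * 4 ^ i)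
        = ennreal ((1 - 7 / 8) ^ i * (7 / 8) * (4 * 4 ^ i))"
      by (subst ennreal_mult[symmetric]) simp_all
    then show "ennreal (pmf (geometric_pmf (7 / 8)) i) * ennreal (4 * 4 ^ i)
        = ennreal ((7 / 2) * (1 / 2) ^ i)"
      by (simp only: eq)
  qed
  also have "\<dots> = (\<Sum>i. ennreal ((7 / 2) * (1 / 2) ^ i))"
    by (rule nn_integral_count_space_nat)
  also have "\<dots> < \<infinity>"
    by (subst suminf_ennreal2) (auto intro!: summable_mult summable_geometric)
  finally show ?thesis .
qed

text \<open>The increment agrees with \<open>h\<close> for indices below \<open>n\<close> and
  vanishes beyond, so the error is dominated by \<open>h\<close> and eventually zero at each
  point.\<close>

lemma digit_sum_D_tendsto:
  defines "h \<equiv> \<lambda>z. - 2 * 2 ^ fst z * rademacher (fst z) (snd z)"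
  shows "h \<in> borel_measurable flip_choice"
    and "(\<lambda>n. \<integral>\<^sup>+z. ennreal ((flips.D (digit_sum n) z - h z)\<^sup>2) \<partial>flip_choice) \<longlonglongrightarrow> 0"
proof -
  show [measurable]: "h \<in> borel_measurable flip_choice"
    unfolding h_def by (rule index_measurable) measurable
  have D [measurable]: "flips.D (digit_sum n) \<in> borel_measurable flip_choice" for n
    by (rule flips.D_measurable) simp
  have hsq: "(h z)\<^sup>2 = 4 * 4 ^ fst z" for z
    using rademacher_cases[of "fst z" "snd z"]
    by (auto simp: h_def power_mult_distrib power2_eq_square simp flip: power_mult_distrib)
  have "(\<lambda>n. \<integral>\<^sup>+z. ennreal ((flips.D (digit_sum n) z - h z)\<^sup>2) \<partial>flip_choice) \<longlonglongrightarrow> (\<integral>\<^sup>+z. 0 \<partial>flip_choice)"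
  proof (rule nn_integral_dominated_convergence[where w = "\<lambda>z. ennreal ((h z)\<^sup>2)"])
    show "AE z in flip_choice. ennreal ((flips.D (digit_sum n) z - h z)\<^sup>2) \<le> ennreal ((h z)\<^sup>2)" for n
      by (rule AE_I2) (simp add: D_digit_sum h_def)
    show "AE z in flip_choice. (\<lambda>n. ennreal ((flips.D (digit_sum n) z - h z)\<^sup>2)) \<longlonglongrightarrow> 0"
    proof (rule AE_I2, rule tendsto_eventually)
      fix z
      show "\<forall>\<^sub>F n in sequentially. ennreal ((flips.D (digit_sum n) z - h z)\<^sup>2) = 0"
        using eventually_gt_at_top[of "fst z"] by eventually_elim (simp add: D_digit_sum h_def)
    qed
    \<comment> \<open>\<open>(h z)^2\<close> depends on the index alone, so Tonelli leaves the
      geometric integral.\<close>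
    have "(\<integral>\<^sup>+z. ennreal ((h z)\<^sup>2) \<partial>flip_choice)
        = (\<integral>\<^sup>+i. \<integral>\<^sup>+x. ennreal ((h (i, x))\<^sup>2) \<partial>unit_lborel \<partial>flip_index)"
      by (rule unit.nn_integral_fst[symmetric]) measurable
    also have "\<dots> = (\<integral>\<^sup>+i. ennreal (4 * 4 ^ i) \<partial>flip_index)"
      using unit.emeasure_space_1 by (simp add: hsq)
    finally show "(\<integral>\<^sup>+z. ennreal ((h z)\<^sup>2) \<partial>flip_choice) < \<infinity>"
      using nn_integral_geometric_4_power by simp
  qed measurable
  then show "(\<lambda>n. \<integral>\<^sup>+z. ennreal ((flips.D (digit_sum n) z - h z)\<^sup>2) \<partial>flip_choice) \<longlonglongrightarrow> 0"
    by simp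
qed

lemma not_hilbert_space_flips:
  "\<not> hilbert_space (quot_space unit_lborel flips.E) (quot_add unit_lborel) (quot_zero unit_lborel)
      (quot_scale unit_lborel) (quot_inner unit_lborel flips.E)"
proof
  assume "hilbert_space (quot_space unit_lborel flips.E) (quot_add unit_lborel) (quot_zero unit_lborel)
      (quot_scale unit_lborel) (quot_inner unit_lborel flips.E)"
  \<comment> \<open>Completeness would give the limiting increments a primitive, excluded by
    \<open>no_flip_primitive\<close>.\<close>
  from flips.hilbert_space_imp_closed_range[OF this digit_sum_ext_domain digit_sum_D_tendsto]
  obtain f where f: "f \<in> borel_measurable unit_lborel"
    and "AE z in flip_choice. flips.D f z = - 2 * 2 ^ fst z * rademacher (fst z) (snd z)" .
  then have D: "AE x in unit_lborel. f (flip i x) - f x = - 2 * 2 ^ i * rademacher i x" for i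
    using AE_flip_choiceD[of "\<lambda>i x. f (flip i x) - f x = - 2 * 2 ^ i * rademacher i x"]
    by (simp add: flips.D_def)
  have "AE x in unit_lborel. \<bar>f (flip i x) - f x\<bar> = 2 * 2 ^ i" for i
    using D[of i] by eventually_elim (simp add: abs_mult)
  with f show False
    by (intro no_flip_primitive[of f]) (auto cong: measurable_cong_sets)
qed

theorem corollary6p3:
  "\<exists>(M :: real measure) (E :: (real \<Rightarrow> real) \<Rightarrow> ennreal).
     sigma_finite_measure M \<and>
     dirichlet_form M E \<and>
     irreducible_form M E \<and>
     ext_kernel M E = ae_constants M \<and>
     inner_product_space (quot_space M E) (quot_add M) (quot_zero M) (quot_scale M) (quot_inner M E) \<and>
     \<not> hilbert_space (quot_space M E) (quot_add M) (quot_zero M) (quot_scale M) (quot_inner M E)"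
  using unit.sigma_finite_measure_axioms flips.dirichlet_form_E flips.irreducible_form_E
    flips.ext_kernel_E flips.inner_product_space_E not_hilbert_space_flips
  by blast

end
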